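(* Let $E_1$ and $E_2$ be countable directed graphs, let $K$ be an uncountable algebraically closed field, and let $K\subseteq F_1$ and $K\subseteq F_2$ be two field extensions. Then $L_{F_1}(E_1)\cong L_{F_1}(E_2)$ as $F_1$-algebras if and only if $L_{F_2}(E_1)\cong L_{F_2}(E_2)$ as $F_2$-algebras.
   Context: A directed graph $E=(E^0,E^1,r,s)$ consists of two sets $E^0$ (vertices) and $E^1$ (edges) and functions $r,s\colon E^1\to E^0$; it is countable if $|E^0\cup E^1|\le\aleph_0$. A vertex $v$ is regular if $s^{-1}(v)$ is a finite non-empty set; $\mathrm{Reg}(E)$ is the set of regular vertices. For a commutative unital ring $R$, the Leavitt path algebra $L_R(E)$ is the free (associative, not necessarily unital) $R$-algebra generated by $E^0\cup E^1\cup\{e^*: e\in E^1\}$ subject to the relations: (V) $vw=\delta_{v,w}v$ for $v,w\in E^0$; (E1) $s(e)e=er(e)=e$ for $e\in E^1$; (E2) $r(e)e^*=e^*s(e)=e^*$ for $e\in E^1$; (CK1) $e^*f=\delta_{e,f}r(e)$ for $e,f\in E^1$; (CK2) $v=\sum_{e\in s^{-1}(v)}ee^*$ for every $v\in\mathrm{Reg}(E)$. *)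

theory Defs
  imports
    "HOL-Library.Countable_Set"
    "HOL-Library.Poly_Mapping"
    "HOL-Computational_Algebra.Polynomial"
    "HOL-Algebra.Congruence"
    "Graph_Theory.Digraph"
begin

section \<open>Free associative algebras\<close>

text \<open>
  The free monoid on the type \<open>'x\<close>. The monoid is written additively because this is the
  convention of \<^theory>\<open>HOL-Library.Poly_Mapping\<close>: with a monoid \<open>'m\<close> of exponents,
  the type \<open>'m \<Rightarrow>\<^sub>0 'r\<close> carries the convolution product of the monoid ring.
\<close>

datatype 'x gword = GWord (letters: "'x list")

instantiation gword :: (type) monoid_add
begin

definition zero_gword :: "'a gword" where
  "0 = GWord []"

definition plus_gword :: "'a gword \<Rightarrow> 'a gword \<Rightarrow> 'a gword" where
  "u + w = GWord (letters u @ letters w)"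

instance
  by standard (simp_all add: zero_gword_def plus_gword_def)

end

type_synonym ('x, 'r) free_alg = "'x gword \<Rightarrow>\<^sub>0 'r"

definition gen :: "'x \<Rightarrow> ('x, 'r::comm_ring_1) free_alg" where
  "gen x = Poly_Mapping.single (GWord [x]) 1"

definition scale :: "'r \<Rightarrow> ('x, 'r::comm_ring_1) free_alg \<Rightarrow> ('x, 'r) free_alg" where
  "scale c p = Poly_Mapping.map ((*) c) p"

text \<open>
  The free algebra on a set \<open>X\<close> is not unital: only non-empty words over \<open>X\<close> may occur.
\<close>

definition free_algebra :: "'x set \<Rightarrow> ('x, 'r::comm_ring_1) free_alg set" where
  "free_algebra X = {p. \<forall>w \<in> Poly_Mapping.keys p. letters w \<noteq> [] \<and> set (letters w) \<subseteq> X}"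

text \<open>
  The two-sided algebra ideal of \<open>A\<close> generated by \<open>S \<subseteq> A\<close>. As \<open>A\<close> need not have a unit,
  closure under scalars is required separately.
\<close>

inductive_set ideal_generated ::
  "('x, 'r::comm_ring_1) free_alg set \<Rightarrow> ('x, 'r) free_alg set \<Rightarrow> ('x, 'r) free_alg set"
  for A S where
  base: "p \<in> S \<Longrightarrow> p \<in> ideal_generated A S"
| zero: "0 \<in> ideal_generated A S"
| add: "p \<in> ideal_generated A S \<Longrightarrow> q \<in> ideal_generated A S \<Longrightarrow> p + q \<in> ideal_generated A S"
| scale: "p \<in> ideal_generated A S \<Longrightarrow> scale c p \<in> ideal_generated A S"
| mult_left: "a \<in> A \<Longrightarrow> p \<in> ideal_generated A S \<Longrightarrow> a * p \<in> ideal_generated A S"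
| mult_right: "a \<in> A \<Longrightarrow> p \<in> ideal_generated A S \<Longrightarrow> p * a \<in> ideal_generated A S"


section \<open>Not necessarily unital algebras and their isomorphisms\<close>

record ('r, 'a) nonunital_algebra = "'a partial_object" +
  alg_add :: "'a \<Rightarrow> 'a \<Rightarrow> 'a"
  alg_mult :: "'a \<Rightarrow> 'a \<Rightarrow> 'a"
  alg_smult :: "'r \<Rightarrow> 'a \<Rightarrow> 'a"

definition algebra_isomorphic ::
  "('r, 'a) nonunital_algebra \<Rightarrow> ('r, 'b) nonunital_algebra \<Rightarrow> bool" where
  "algebra_isomorphic A B \<longleftrightarrow>
    (\<exists>\<phi>. bij_betw \<phi> (carrier A) (carrier B) \<and>
      (\<forall>x \<in> carrier A. \<forall>y \<in> carrier A. \<phi> (alg_add A x y) = alg_add B (\<phi> x) (\<phi> y)) \<and>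
      (\<forall>x \<in> carrier A. \<forall>y \<in> carrier A. \<phi> (alg_mult A x y) = alg_mult B (\<phi> x) (\<phi> y)) \<and>
      (\<forall>c. \<forall>x \<in> carrier A. \<phi> (alg_smult A c x) = alg_smult B c (\<phi> x)))"

definition ideal_coset ::
  "('x, 'r::comm_ring_1) free_alg set \<Rightarrow> ('x, 'r) free_alg \<Rightarrow> ('x, 'r) free_alg set" where
  "ideal_coset I p = (\<lambda>q. p + q) ` I"

text \<open>
  The operations are unions over all representatives, as in HOL-Algebra's quotient rings; for an
  ideal \<open>I\<close> of \<open>A\<close> all members of each union coincide, see \<open>quotient_algebra_ops\<close> below.
\<close>

definition quotient_algebra ::
  "('x, 'r::comm_ring_1) free_alg set \<Rightarrow> ('x, 'r) free_alg set
    \<Rightarrow> ('r, ('x, 'r) free_alg set) nonunital_algebra" where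
  "quotient_algebra A I =
    \<lparr>carrier = ideal_coset I ` A,
     alg_add = (\<lambda>P Q. \<Union>p \<in> P. \<Union>q \<in> Q. ideal_coset I (p + q)),
     alg_mult = (\<lambda>P Q. \<Union>p \<in> P. \<Union>q \<in> Q. ideal_coset I (p * q)),
     alg_smult = (\<lambda>c P. \<Union>p \<in> P. ideal_coset I (scale c p))\<rparr>"


section \<open>Leavitt path algebras\<close>

text \<open>
  A directed graph \<open>(E\<^sup>0, E\<^sup>1, r, s)\<close> is a \<^typ>\<open>('v, 'e) pre_digraph\<close> satisfying
  \<^locale>\<open>wf_digraph\<close>, with \<open>E\<^sup>0 = verts E\<close>, \<open>E\<^sup>1 = arcs E\<close>, \<open>s = tail E\<close> and
  \<open>r = head E\<close>; loops, parallel edges and infinite graphs are allowed.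
\<close>

definition regular_vertices :: "('v, 'e) pre_digraph \<Rightarrow> 'v set" where
  "regular_vertices E = {v \<in> verts E. finite (out_arcs E v) \<and> out_arcs E v \<noteq> {}}"

text \<open>\<open>Ghost e\<close> stands for the generator \<open>e\<^sup>*\<close>.\<close>

datatype ('v, 'e) lpa_gen = Vertex 'v | Edge 'e | Ghost 'e

definition lpa_gens :: "('v, 'e) pre_digraph \<Rightarrow> ('v, 'e) lpa_gen set" where
  "lpa_gens E = Vertex ` verts E \<union> Edge ` arcs E \<union> Ghost ` arcs E"

text \<open>A relation \<open>lhs = rhs\<close> is encoded by the element \<open>lhs - rhs\<close>.\<close>

inductive_set lpa_relators ::
  "('v, 'e) pre_digraph \<Rightarrow> (('v, 'e) lpa_gen, 'r::comm_ring_1) free_alg set"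
  for E where
  V: "v \<in> verts E \<Longrightarrow> w \<in> verts E \<Longrightarrow>
    gen (Vertex v) * gen (Vertex w) - (if v = w then gen (Vertex v) else 0) \<in> lpa_relators E"
| E1_source: "e \<in> arcs E \<Longrightarrow>
    gen (Vertex (tail E e)) * gen (Edge e) - gen (Edge e) \<in> lpa_relators E"
| E1_range: "e \<in> arcs E \<Longrightarrow>
    gen (Edge e) * gen (Vertex (head E e)) - gen (Edge e) \<in> lpa_relators E"
| E2_range: "e \<in> arcs E \<Longrightarrow>
    gen (Vertex (head E e)) * gen (Ghost e) - gen (Ghost e) \<in> lpa_relators E"
| E2_source: "e \<in> arcs E \<Longrightarrow>
    gen (Ghost e) * gen (Vertex (tail E e)) - gen (Ghost e) \<in> lpa_relators E"
| CK1: "e \<in> arcs E \<Longrightarrow> f \<in> arcs E \<Longrightarrow>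
    gen (Ghost e) * gen (Edge f) - (if e = f then gen (Vertex (head E e)) else 0)
      \<in> lpa_relators E"
| CK2: "v \<in> regular_vertices E \<Longrightarrow>
    gen (Vertex v) - (\<Sum>e \<in> out_arcs E v. gen (Edge e) * gen (Ghost e)) \<in> lpa_relators E"

text \<open>The type argument fixes the coefficient ring.\<close>

definition leavitt_path_algebra ::
  "'r::comm_ring_1 itself \<Rightarrow> ('v, 'e) pre_digraph
    \<Rightarrow> ('r, (('v, 'e) lpa_gen, 'r) free_alg set) nonunital_algebra" where
  "leavitt_path_algebra _ E =
    quotient_algebra (free_algebra (lpa_gens E))
      (ideal_generated (free_algebra (lpa_gens E)) (lpa_relators E))"


section \<open>Field extensions\<close>

text \<open>
  An extension \<open>K \<subseteq> F\<close> is given by its inclusion map, a unital ring homomorphism; it is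
  automatically injective.
\<close>

definition field_extension :: "('k::field \<Rightarrow> 'f::field) \<Rightarrow> bool" where
  "field_extension \<iota> \<longleftrightarrow>
    \<iota> 1 = 1 \<and> (\<forall>x y. \<iota> (x + y) = \<iota> x + \<iota> y) \<and> (\<forall>x y. \<iota> (x * y) = \<iota> x * \<iota> y)"


section \<open>Sanity checks\<close>

lemma field_extension_inj:
  assumes "field_extension \<iota>"
  shows "inj \<iota>"
proof (rule injI, rule ccontr)
  fix x y assume eq: "\<iota> x = \<iota> y" and "x \<noteq> y"
  have add: "\<iota> (a + b) = \<iota> a + \<iota> b" and mult: "\<iota> (a * b) = \<iota> a * \<iota> b" and one: "\<iota> 1 = 1" for a b
    using assms by (auto simp: field_extension_def)
  have "\<iota> (x - y) = 0"
    using add[of "x - y" y] eq by simp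
  then have "\<iota> ((x - y) * inverse (x - y)) = 0"
    by (simp add: mult)
  then show False
    using \<open>x \<noteq> y\<close> one by simp
qed

lemma scale_eq_single: "scale c p = Poly_Mapping.single 0 c * p"
  unfolding scale_def by (rule mult_map_scale_conv_mult)

lemma free_algebra_0: "0 \<in> free_algebra X"
  by (simp add: free_algebra_def)

lemma free_algebra_add: "p \<in> free_algebra X \<Longrightarrow> q \<in> free_algebra X \<Longrightarrow> p + q \<in> free_algebra X"
  using Poly_Mapping.keys_add[of p q] by (auto simp: free_algebra_def)

lemma free_algebra_diff: "p \<in> free_algebra X \<Longrightarrow> q \<in> free_algebra X \<Longrightarrow> p - q \<in> free_algebra X"
  using Poly_Mapping.keys_add[of p "- q"] by (auto simp: free_algebra_def)

lemma free_algebra_mult: "p \<in> free_algebra X \<Longrightarrow> q \<in> free_algebra X \<Longrightarrow> p * q \<in> free_algebra X"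
  using Poly_Mapping.keys_mult[of p q]
  by (fastforce simp: free_algebra_def plus_gword_def)

lemma free_algebra_scale: "p \<in> free_algebra X \<Longrightarrow> scale c p \<in> free_algebra X"
  using Poly_Mapping.keys_mult[of "Poly_Mapping.single 0 c" p]
  by (fastforce simp: scale_eq_single free_algebra_def split: if_splits)

lemma free_algebra_gen: "x \<in> X \<Longrightarrow> gen x \<in> free_algebra X"
  by (simp add: free_algebra_def gen_def)

lemma free_algebra_sum: "(\<And>i. i \<in> J \<Longrightarrow> f i \<in> free_algebra X) \<Longrightarrow> sum f J \<in> free_algebra X"
  by (induction J rule: infinite_finite_induct) (auto intro: free_algebra_0 free_algebra_add)

lemma lpa_relators_subset:
  assumes "wf_digraph E"
  shows "lpa_relators E \<subseteq> free_algebra (lpa_gens E)"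
proof
  interpret wf_digraph E by fact
  fix p :: "(('a, 'b) lpa_gen, 'c) free_alg"
  assume "p \<in> lpa_relators E"
  then show "p \<in> free_algebra (lpa_gens E)"
    by induction
      (auto simp: lpa_gens_def regular_vertices_def out_arcs_def
        intro!: free_algebra_diff free_algebra_mult free_algebra_gen free_algebra_sum free_algebra_0)
qed

lemma ideal_generated_subset:
  assumes "S \<subseteq> free_algebra X"
  shows "ideal_generated (free_algebra X) S \<subseteq> free_algebra X"
proof
  fix p assume "p \<in> ideal_generated (free_algebra X) S"
  then show "p \<in> free_algebra X"
    using assms
    by induction
      (auto intro: free_algebra_0 free_algebra_add free_algebra_mult free_algebra_scale)
qed

lemma ideal_generated_diff:
  assumes "p \<in> ideal_generated A S" "q \<in> ideal_generated A S"
  shows "p - q \<in> ideal_generated A S"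
proof -
  have "scale (- 1) q = - q"
    by (simp add: scale_eq_single single_uminus)
  then show ?thesis
    using ideal_generated.add[OF assms(1) ideal_generated.scale[OF assms(2), of "- 1"]] by simp
qed

lemma ideal_coset_eq_iff:
  "ideal_coset (ideal_generated A S) p = ideal_coset (ideal_generated A S) q
    \<longleftrightarrow> p - q \<in> ideal_generated A S" (is "?l \<longleftrightarrow> ?r")
proof
  assume ?l
  moreover have "p \<in> ideal_coset (ideal_generated A S) p"
    by (auto simp: ideal_coset_def image_iff intro!: bexI[of _ 0] ideal_generated.zero)
  ultimately obtain z where "z \<in> ideal_generated A S" "p = q + z"
    by (auto simp: ideal_coset_def)
  then show ?r by simp
next
  assume r: ?r
  have "x - p \<in> ideal_generated A S \<longleftrightarrow> x - q \<in> ideal_generated A S" for x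
    using ideal_generated.add[OF _ r, of "x - p"] ideal_generated_diff[OF _ r, of "x - q"]
    by (auto simp: algebra_simps)
  moreover have "x \<in> ideal_coset (ideal_generated A S) y \<longleftrightarrow> x - y \<in> ideal_generated A S" for x y
    by (auto simp: ideal_coset_def image_iff intro: bexI[of _ "x - y"])
  ultimately show ?l by blast
qed

lemma quotient_algebra_ops:
  fixes X :: "'x set" and S :: "('x, 'r::comm_ring_1) free_alg set"
  defines "A \<equiv> free_algebra X"
  defines "I \<equiv> ideal_generated A S"
  assumes "S \<subseteq> A" "p \<in> A" "q \<in> A"
  shows "alg_add (quotient_algebra A I) (ideal_coset I p) (ideal_coset I q) = ideal_coset I (p + q)"
    and "alg_mult (quotient_algebra A I) (ideal_coset I p) (ideal_coset I q) = ideal_coset I (p * q)"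
    and "alg_smult (quotient_algebra A I) c (ideal_coset I p) = ideal_coset I (scale c p)"
proof -
  have IA: "I \<subseteq> A"
    using ideal_generated_subset[of S X] assms by simp
  have ne: "I \<noteq> {}"
    using ideal_generated.zero unfolding I_def by blast
  have "ideal_coset I ((p + x) + (q + y)) = ideal_coset I (p + q)" if "x \<in> I" "y \<in> I" for x y
    using that unfolding I_def ideal_coset_eq_iff
    by (simp add: algebra_simps ideal_generated.add)
  then show "alg_add (quotient_algebra A I) (ideal_coset I p) (ideal_coset I q)
      = ideal_coset I (p + q)"
    using ne by (simp add: quotient_algebra_def ideal_coset_def[of I p] ideal_coset_def[of I q])
  have "ideal_coset I ((p + x) * (q + y)) = ideal_coset I (p * q)" if "x \<in> I" "y \<in> I" for x y
  proof -
    have "(p + x) * (q + y) - p * q = p * y + x * (q + y)"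
      by (simp add: algebra_simps)
    moreover have "q + y \<in> A"
      using IA that assms by (auto intro: free_algebra_add)
    ultimately show ?thesis
      using that \<open>p \<in> A\<close> unfolding I_def ideal_coset_eq_iff
      by (auto intro: ideal_generated.intros)
  qed
  then show "alg_mult (quotient_algebra A I) (ideal_coset I p) (ideal_coset I q)
      = ideal_coset I (p * q)"
    using ne by (simp add: quotient_algebra_def ideal_coset_def[of I p] ideal_coset_def[of I q])
  have "ideal_coset I (scale c (p + x)) = ideal_coset I (scale c p)" if "x \<in> I" for x
    using that ideal_generated.scale[of x A S c] unfolding I_def ideal_coset_eq_iff
    by (simp add: scale_eq_single algebra_simps)
  then show "alg_smult (quotient_algebra A I) c (ideal_coset I p) = ideal_coset I (scale c p)"
    using ne by (simp add: quotient_algebra_def ideal_coset_def[of I p])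
qed

end

theory Submission
  imports Defs
begin

text \<open>
  By symmetry it is enough to carry an isomorphism over \<open>F\<^sub>1\<close> to one over \<open>F\<^sub>2\<close>. The idea is that
  an isomorphism of Leavitt path algebras of countable graphs involves only countably many
  scalars, and that countably many elements of \<open>F\<^sub>1\<close> always generate a ring with a copy
  inside \<open>F\<^sub>2\<close>.

  An isomorphism is determined by the images of the generators, lifted to free algebras, and
  so is its inverse. That these lifts do define mutually inverse homomorphisms amounts to
  countably many memberships in the defining ideals
  (\<open>isomorphic_if_inverse_substitutions\<close>, \<open>inverse_substitutions_if_isomorphic\<close>). An element
  of such an ideal has a finite expression in the relators, and applying a ring
  homomorphism to the scalars of that expression proves the corresponding membership over
  another ring. This works for Leavitt path algebras because their relators have integer
  coefficients, so that they look the same over every ring. Hence there is a countable set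
  \<open>C \<subseteq> F\<^sub>1\<close> such that every embedding into \<open>F\<^sub>2\<close> of a subring containing \<open>C\<close> turns the
  isomorphism over \<open>F\<^sub>1\<close> into one over \<open>F\<^sub>2\<close> (\<open>inverse_substitutions_transfer\<close>).

  The embedding is found in \<open>K\<close>, which lies in \<open>F\<^sub>2\<close> (\<open>countable_partial_embedding\<close>). The
  fields \<open>F\<^sub>1\<close> and \<open>K\<close> have the same characteristic, so the image of \<open>\<int>\<close> in \<open>F\<^sub>1\<close> embeds
  into \<open>K\<close>; the elements of \<open>C\<close> are then adjoined one after the other. An algebraic element is
  sent to a root of the image of its minimal equation, which exists because \<open>K\<close> is
  algebraically closed. A transcendental element is sent to an element of \<open>K\<close> that is
  transcendental over the countable image obtained so far, which exists because \<open>K\<close> is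
  uncountable.
\<close>

section \<open>Partial embeddings of rings\<close>

text \<open>
  The graph of an isomorphism between a subring of \<open>'a\<close> and a subring of \<open>'b\<close>: it is itself a
  subring of \<open>'a \<times> 'b\<close>, and the last condition makes it single-valued in both directions. In
  this symmetric form the inverse needs no separate treatment and a union of a chain is a
  union of sets.
\<close>

locale partial_embedding =
  fixes G :: "('a::comm_ring_1 \<times> 'b::comm_ring_1) set"
  assumes one: "(1, 1) \<in> G"
    and diff: "(a, b) \<in> G \<Longrightarrow> (c, d) \<in> G \<Longrightarrow> (a - c, b - d) \<in> G"
    and mult: "(a, b) \<in> G \<Longrightarrow> (c, d) \<in> G \<Longrightarrow> (a * c, b * d) \<in> G"
    and zero_iff: "(a, b) \<in> G \<Longrightarrow> a = 0 \<longleftrightarrow> b = 0"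
begin

lemma zero: "(0, 0) \<in> G"
  using diff[OF one one] by simp

lemma add: "(a, b) \<in> G \<Longrightarrow> (c, d) \<in> G \<Longrightarrow> (a + c, b + d) \<in> G"
  using diff[of a b "- c" "- d"] diff[OF zero, of c d] by simp

lemma sum: "(\<And>i. i \<in> I \<Longrightarrow> (f i, g i) \<in> G) \<Longrightarrow> (sum f I, sum g I) \<in> G"
  by (induction I rule: infinite_finite_induct) (auto intro: zero add)

lemma unique: "(a, b) \<in> G \<Longrightarrow> (a, b') \<in> G \<Longrightarrow> b = b'"
  using diff[of a b a b'] zero_iff[of 0 "b - b'"] by auto

lemma converse: "partial_embedding (G\<inverse>)"
proof
  show "(1, 1) \<in> G\<inverse>" using one by blast
  show "a = 0 \<longleftrightarrow> b = 0" if "(a, b) \<in> G\<inverse>" for a b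
    using zero_iff[of b a] that by blast
qed (use diff mult in blast)+

end

section \<open>Embedding countably many elements into a large field\<close>

definition poly_rel ::
  "('a::comm_ring_1 \<times> 'b::comm_ring_1) set \<Rightarrow> 'a poly \<Rightarrow> 'b poly \<Rightarrow> bool" where
  "poly_rel G P Q \<longleftrightarrow> (\<forall>i. (coeff P i, coeff Q i) \<in> G)"

context partial_embedding
begin

lemma poly_rel_diff: "poly_rel G P Q \<Longrightarrow> poly_rel G P' Q' \<Longrightarrow> poly_rel G (P - P') (Q - Q')"
  by (auto simp: poly_rel_def intro: diff)

lemma poly_rel_add: "poly_rel G P Q \<Longrightarrow> poly_rel G P' Q' \<Longrightarrow> poly_rel G (P + P') (Q + Q')"
  by (auto simp: poly_rel_def intro: add)

lemma poly_rel_mult: "poly_rel G P Q \<Longrightarrow> poly_rel G P' Q' \<Longrightarrow> poly_rel G (P * P') (Q * Q')"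
  by (auto simp: poly_rel_def coeff_mult intro: sum mult)

lemma poly_rel_smult: "(c, d) \<in> G \<Longrightarrow> poly_rel G P Q \<Longrightarrow> poly_rel G (smult c P) (smult d Q)"
  by (auto simp: poly_rel_def intro: mult)

lemma poly_rel_monom: "(c, d) \<in> G \<Longrightarrow> poly_rel G (monom c n) (monom d n)"
  by (auto simp: poly_rel_def intro: zero)

lemma poly_rel_0: "poly_rel G 0 0"
  by (auto simp: poly_rel_def intro: zero)

lemma poly_rel_coeff_eq_0_iff: "poly_rel G P Q \<Longrightarrow> coeff P i = 0 \<longleftrightarrow> coeff Q i = 0"
  unfolding poly_rel_def using zero_iff[of "coeff P i" "coeff Q i"] by blast

lemma poly_rel_eq_0_iff: "poly_rel G P Q \<Longrightarrow> P = 0 \<longleftrightarrow> Q = 0"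
  by (simp add: poly_eq_iff poly_rel_coeff_eq_0_iff)

lemma poly_rel_degree: "poly_rel G P Q \<Longrightarrow> degree P = degree Q"
  by (simp add: degree_def poly_rel_coeff_eq_0_iff)

end

text \<open>
  The division is carried out in parallel for a polynomial and its image. Multiplying by a power
  of the leading coefficient instead of dividing by it keeps all coefficients in the
  given subring. The condition on \<open>R\<close> replaces
  \<open>degree R < degree D\<close>, which would not cover a constant \<open>D\<close> and \<open>R = 0\<close>.
\<close>

lemma poly_rel_pseudo_division:
  fixes G :: "('a::idom \<times> 'b::idom) set"
  assumes "partial_embedding G" and "poly_rel G P Q" and "poly_rel G D E" and "D \<noteq> 0"
  obtains c d S T R U where "(c, d) \<in> G" "c \<noteq> 0"
    and "poly_rel G S T" "poly_rel G R U"
    and "smult c P = D * S + R" "smult d Q = E * T + U"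
    and "\<forall>i \<ge> degree D. coeff R i = 0"
proof -
  interpret partial_embedding G by fact
  have DE: "degree D = degree E" "poly_rel G D E" "(lead_coeff D, lead_coeff E) \<in> G"
    using assms(3) poly_rel_degree[OF assms(3)] unfolding poly_rel_def by auto
  have "\<exists>c d S T R U. (c, d) \<in> G \<and> c \<noteq> 0 \<and> poly_rel G S T \<and> poly_rel G R U \<and>
      smult c P = D * S + R \<and> smult d Q = E * T + U \<and> (\<forall>i \<ge> degree D. coeff R i = 0)"
    if "\<forall>i \<ge> n. coeff P i = 0" for n
    using that assms(2)
  proof (induction n arbitrary: P Q)
    case 0
    then have "P = 0" "Q = 0"
      using poly_rel_eq_0_iff[OF 0(2)] by (auto simp: poly_eq_iff)
    then show ?case
      using one poly_rel_0 by (intro exI[of _ 1] exI[of _ 0]) auto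
  next
    case (Suc n)
    show ?case
    proof (cases "Suc n \<le> degree D")
      case True
      then show ?thesis
        using one poly_rel_0 Suc.prems
        by (intro exI[of _ 1] exI[of _ 0] exI[of _ P] exI[of _ Q]) auto
    next
      case False
      (* Multiplying P by the leading coefficient of D and subtracting M * D cancels the
         coefficient of index n. *)
      define k where "k = n - degree D"
      define M N where "M = monom (coeff P n) k" and "N = monom (coeff Q n) k"
      define P1 where "P1 = smult (lead_coeff D) P - M * D"
      define Q1 where "Q1 = smult (lead_coeff E) Q - N * E"
      have MN: "poly_rel G M N"
        unfolding M_def N_def using Suc.prems(2) by (intro poly_rel_monom) (simp add: poly_rel_def)
      have rel1: "poly_rel G P1 Q1"
        unfolding P1_def Q1_def using MN DE Suc.prems
        by (intro poly_rel_diff poly_rel_smult poly_rel_mult) auto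
      have "coeff P1 i = 0" if "i \<ge> n" for i
      proof (cases "i = n")
        case True
        with False have "coeff (M * D) i = coeff P n * lead_coeff D"
          by (simp add: M_def coeff_monom_mult k_def)
        then show ?thesis using True by (simp add: P1_def)
      next
        case i: False
        with that have "coeff P i = 0" using Suc.prems(1) by auto
        moreover from i that have "coeff D (i - k) = 0"
          using False by (intro coeff_eq_0) (auto simp: k_def)
        ultimately show ?thesis
          by (simp add: P1_def M_def coeff_monom_mult)
      qed
      then obtain c d S T R U where *: "(c, d) \<in> G" "c \<noteq> 0"
        "poly_rel G S T" "poly_rel G R U" "smult c P1 = D * S + R" "smult d Q1 = E * T + U"
        "\<forall>i \<ge> degree D. coeff R i = 0"
        using Suc.IH[OF _ rel1] by blast
      have "smult (c * lead_coeff D) P = smult c P1 + smult c (M * D)"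
        "smult (d * lead_coeff E) Q = smult d Q1 + smult d (N * E)"
        by (simp_all add: P1_def Q1_def smult_diff_right)
      then have "smult (c * lead_coeff D) P = D * (S + smult c M) + R"
        "smult (d * lead_coeff E) Q = E * (T + smult d N) + U"
        using * by (simp_all add: algebra_simps)
      moreover have "poly_rel G (S + smult c M) (T + smult d N)"
        using * MN by (intro poly_rel_add poly_rel_smult)
      moreover have "(c * lead_coeff D, d * lead_coeff E) \<in> G"
        using *(1) DE(3) by (rule mult)
      moreover have "c * lead_coeff D \<noteq> 0"
        using *(2) \<open>D \<noteq> 0\<close> by simp
      ultimately show ?thesis
        using *(4,7) by blast
    qed
  qed
  from this[of "Suc (degree P)"] show ?thesis
    using that by (auto simp: coeff_eq_0)
qed

lemma countable_polys_over:
  assumes "countable (A :: 'a::zero set)"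
  shows "countable {P. \<forall>i. coeff P i \<in> A}"
proof (rule countable_image_inj_on)
  have "coeffs ` {P. \<forall>i. coeff P i \<in> A} \<subseteq> lists A"
    by (auto simp: coeffs_def)
  then show "countable (coeffs ` {P. \<forall>i. coeff P i \<in> A})"
    using countable_lists[OF assms] countable_subset by blast
qed (auto simp: inj_on_def coeffs_eq_iff)

text \<open>
  Only countably many polynomials have coefficients in the image of \<open>G\<close>, so some \<open>b\<close> is a root of
  none of them except \<open>0\<close>; the zero polynomial is then the only one vanishing at \<open>a\<close>, and
  the only one whose image vanishes at \<open>b\<close>.
\<close>

lemma poly_rel_transcendental_point:
  fixes G :: "('a::idom \<times> 'b::idom) set"
  assumes "partial_embedding G" and "countable G" and "uncountable (UNIV :: 'b set)"
    and trans: "\<And>P Q. poly_rel G P Q \<Longrightarrow> poly P a = 0 \<Longrightarrow> P = 0"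
  shows "\<exists>b. \<forall>P Q. poly_rel G P Q \<longrightarrow> (poly P a = 0 \<longleftrightarrow> poly Q b = 0)"
proof -
  interpret partial_embedding G by fact
  let ?Z = "\<Union>Q \<in> {Q. \<forall>i. coeff Q i \<in> snd ` G} - {0}. {b. poly Q b = 0}"
  have "countable ?Z"
    using countable_polys_over[OF countable_image[OF assms(2)], of snd]
    by (intro countable_UN) (auto intro!: countable_finite poly_roots_finite)
  then have "?Z \<noteq> UNIV"
    using assms(3) by metis
  then obtain b where b: "b \<notin> ?Z" by blast
  have "poly P a = 0 \<longleftrightarrow> poly Q b = 0" if rel: "poly_rel G P Q" for P Q
  proof -
    have "\<forall>i. coeff Q i \<in> snd ` G"
      using rel unfolding poly_rel_def by force
    then have "poly Q b = 0 \<Longrightarrow> Q = 0" using b by auto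
    then show ?thesis
      using trans[OF rel] poly_rel_eq_0_iff[OF rel] by auto
  qed
  then show ?thesis by blast
qed

text \<open>
  Here \<open>b\<close> is a root of the image \<open>Q\<close> of a nonzero polynomial \<open>P\<close> of least degree vanishing
  at \<open>a\<close>. Dividing by \<open>P\<close> shows that every polynomial that vanishes at \<open>a\<close> has an image that
  vanishes at \<open>b\<close>. The converse expresses that \<open>P\<close> is irreducible over the fraction field: a
  counterexample \<open>D\<close> of least degree would give, up to scalars, a proper factor of \<open>P\<close>
  that does not vanish at \<open>a\<close>, and the complementary factor would contradict the minimality
  of \<open>P\<close>.
\<close>

lemma poly_rel_algebraic_point:
  fixes G :: "('a::idom \<times> 'b::alg_closed_field) set"
  assumes pe: "partial_embedding G"
    and ex: "poly_rel G P\<^sub>0 Q\<^sub>0" "poly P\<^sub>0 a = 0" "P\<^sub>0 \<noteq> 0"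
  shows "\<exists>b. \<forall>P Q. poly_rel G P Q \<longrightarrow> (poly P a = 0 \<longleftrightarrow> poly Q b = 0)"
proof -
  interpret partial_embedding G by fact
  obtain P Q where P: "poly_rel G P Q" "poly P a = 0" "P \<noteq> 0"
    and least: "\<And>P' Q'. poly_rel G P' Q' \<Longrightarrow> poly P' a = 0 \<Longrightarrow> P' \<noteq> 0 \<Longrightarrow> degree P \<le> degree P'"
    using ex_has_least_nat[where P = "\<lambda>(P, Q). poly_rel G P Q \<and> poly P a = 0 \<and> P \<noteq> 0"
        and k = "(P\<^sub>0, Q\<^sub>0)" and m = "\<lambda>(P, Q). degree P"] ex
    by auto
  have minP: "P' = 0" if "poly_rel G P' Q'" "poly P' a = 0" "degree P' < degree P" for P' Q'
    using least[OF that(1,2)] that(3) by auto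
  have "degree P > 0"
  proof (rule ccontr)
    assume "\<not> degree P > 0"
    then obtain c where "P = [:c:]" by (auto elim: degree_eq_zeroE)
    then show False using P by auto
  qed
  have lt: "degree R < degree P" if "\<forall>i \<ge> degree P. coeff R i = 0" for R :: "'a poly"
    using that \<open>degree P > 0\<close> by (metis leading_coeff_0_iff degree_0 not_le)
  obtain b where b: "poly Q b = 0"
    using alg_closed_imp_poly_has_root[of Q] \<open>degree P > 0\<close> poly_rel_degree[OF P(1)] by auto

  have forward: "poly Q' b = 0" if rel: "poly_rel G P' Q'" and a: "poly P' a = 0" for P' Q'
  proof -
    from poly_rel_pseudo_division[OF pe rel P(1,3)] obtain c d S T R U where
      *: "(c, d) \<in> G" "c \<noteq> 0" "poly_rel G R U"
        "smult c P' = P * S + R" "smult d Q' = Q * T + U" "\<forall>i \<ge> degree P. coeff R i = 0"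
      by metis
    have "poly R a = 0"
      using arg_cong[OF *(4), of "\<lambda>p. poly p a"] a P(2) by simp
    then have "R = 0" using minP *(3) lt[OF *(6)] by blast
    then have "U = 0" using poly_rel_eq_0_iff[OF *(3)] by simp
    then have "d * poly Q' b = 0"
      using arg_cong[OF *(5), of "\<lambda>p. poly p b"] b by simp
    then show ?thesis using *(2) zero_iff[OF *(1)] by simp
  qed

  have backward: "poly P' a = 0" if rel': "poly_rel G P' Q'" and b': "poly Q' b = 0" for P' Q'
  proof (rule ccontr)
    assume "poly P' a \<noteq> 0"
    let ?bad = "\<lambda>(D, E). poly_rel G D E \<and> poly D a \<noteq> 0 \<and> poly E b = 0"
    obtain D E where D: "poly_rel G D E" "poly D a \<noteq> 0" "poly E b = 0"
      and least': "\<And>D' E'. poly_rel G D' E' \<Longrightarrow> poly D' a \<noteq> 0 \<Longrightarrow> poly E' b = 0 \<Longrightarrow> degree D \<le> degree D'"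
      using ex_has_least_nat[where P = ?bad and k = "(P', Q')" and m = "\<lambda>(P, Q). degree P"]
        rel' b' \<open>poly P' a \<noteq> 0\<close>
      by auto
    have minD: "poly D' a = 0"
      if "poly_rel G D' E'" "poly E' b = 0" "degree D' < degree D" for D' E'
      using least'[OF that(1) _ that(2)] that(3) by auto
    have "degree D < degree P"
    proof (rule ccontr)
      assume ge: "\<not> degree D < degree P"
      from poly_rel_pseudo_division[OF pe D(1) P(1,3)] obtain c d S T R U where
        *: "(c, d) \<in> G" "c \<noteq> 0" "poly_rel G R U"
          "smult c D = P * S + R" "smult d E = Q * T + U" "\<forall>i \<ge> degree P. coeff R i = 0"
        by metis
      have "poly R a = c * poly D a" "poly U b = 0"
        using arg_cong[OF *(4), of "\<lambda>p. poly p a"] arg_cong[OF *(5), of "\<lambda>p. poly p b"] P(2) D b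
        by simp_all
      then show False
        using minD[OF *(3)] lt[OF *(6)] ge *(2) D(2) by simp
    qed
    have "D \<noteq> 0" using D(2) by auto
    have "degree D > 0"
    proof (rule ccontr)
      assume "\<not> degree D > 0"
      then have "degree D = 0" "degree E = 0"
        using poly_rel_degree[OF D(1)] by auto
      then obtain c d where "D = [:c:]" "E = [:d:]" by (metis degree_eq_zeroE)
      then show False using D poly_rel_eq_0_iff[OF D(1)] by auto
    qed
    from poly_rel_pseudo_division[OF pe P(1) D(1) \<open>D \<noteq> 0\<close>] obtain c d S T R U where
      *: "(c, d) \<in> G" "c \<noteq> 0" "poly_rel G S T" "poly_rel G R U"
        "smult c P = D * S + R" "smult d Q = E * T + U" "\<forall>i \<ge> degree D. coeff R i = 0"
      by metis
    have "degree R < degree D"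
      using *(7) \<open>degree D > 0\<close> by (metis leading_coeff_0_iff degree_0 not_le)
    moreover have "poly U b = 0"
      using arg_cong[OF *(6), of "\<lambda>p. poly p b"] D b by simp
    ultimately have "poly R a = 0" using minD[OF *(4)] by simp
    then have "R = 0"
      using minP[OF *(4)] \<open>degree R < degree D\<close> \<open>degree D < degree P\<close> by simp
    then have eq: "smult c P = D * S" using *(5) by simp
    then have "S \<noteq> 0" using P(3) *(2) by auto
    have "poly S a = 0"
      using arg_cong[OF eq, of "\<lambda>p. poly p a"] P(2) D(2) by simp
    moreover have "degree P = degree D + degree S"
      using arg_cong[OF eq, of degree] *(2) \<open>S \<noteq> 0\<close> \<open>D \<noteq> 0\<close> by (simp add: degree_mult_eq)
    ultimately show False
      using minP[OF *(3)] \<open>S \<noteq> 0\<close> \<open>degree D > 0\<close> by simp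
  qed
  show ?thesis using forward backward by blast
qed

text \<open>
  The new graph consists of the pairs of values at \<open>a\<close> and \<open>b\<close> of corresponding polynomials, where
  \<open>b\<close> has been chosen so that evaluation at \<open>a\<close> and evaluation at \<open>b\<close> have the same kernel.
\<close>

lemma partial_embedding_adjoin:
  fixes G :: "('a::idom \<times> 'b::alg_closed_field) set"
  assumes "partial_embedding G" and "countable G" and "uncountable (UNIV :: 'b set)"
  shows "\<exists>H. partial_embedding H \<and> countable H \<and> G \<subseteq> H \<and> a \<in> Domain H"
proof -
  interpret partial_embedding G by fact
  obtain b where b: "\<And>P Q. poly_rel G P Q \<Longrightarrow> poly P a = 0 \<longleftrightarrow> poly Q b = 0"
    using poly_rel_transcendental_point[OF assms, of a] poly_rel_algebraic_point[OF assms(1), of _ _ a]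
    by metis
  let ?R = "{(P, Q). poly_rel G P Q}"
  define H where "H = (\<lambda>(P, Q). (poly P a, poly Q b)) ` ?R"
  have HI: "(poly P a, poly Q b) \<in> H" if "poly_rel G P Q" for P Q
    using that unfolding H_def by (auto intro!: image_eqI[of _ _ "(P, Q)"])
  have const: "(x, y) \<in> H" if "(x, y) \<in> G" for x y
    using HI[OF poly_rel_monom[OF that, of 0]] by (simp add: poly_monom)
  have "partial_embedding H"
  proof
    show "(1, 1) \<in> H" using const one .
  next
    fix x y u v assume "(x, y) \<in> H" "(u, v) \<in> H"
    then obtain P Q S T where "poly_rel G P Q" "poly_rel G S T"
      "x = poly P a" "y = poly Q b" "u = poly S a" "v = poly T b"
      by (auto simp: H_def)
    then show "(x - u, y - v) \<in> H" "(x * u, y * v) \<in> H"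
      using HI[OF poly_rel_diff, of P Q S T] HI[OF poly_rel_mult, of P Q S T] by simp_all
  qed (auto simp: H_def b)
  moreover have "countable ?R"
  proof (rule countable_subset)
    show "?R \<subseteq> {P. \<forall>i. coeff P i \<in> fst ` G} \<times> {Q. \<forall>i. coeff Q i \<in> snd ` G}"
      by (force simp: poly_rel_def)
    show "countable ({P. \<forall>i. coeff P i \<in> fst ` G} \<times> {Q. \<forall>i. coeff Q i \<in> snd ` G})"
      using assms(2) by (intro countable_SIGMA countable_polys_over countable_image)
  qed
  moreover have "a \<in> Domain H"
    using HI[OF poly_rel_monom[OF one, of 1]] by (auto simp: poly_monom)
  ultimately show ?thesis
    using const by (intro exI[of _ H]) (auto simp: H_def)
qed

lemma partial_embedding_UN_chain:
  fixes G :: "nat \<Rightarrow> ('a::comm_ring_1 \<times> 'b::comm_ring_1) set"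
  assumes pe: "\<And>n. partial_embedding (G n)" and "\<And>n. G n \<subseteq> G (Suc n)"
  shows "partial_embedding (\<Union>n. G n)"
proof -
  have mono: "G m \<subseteq> G n" if "m \<le> n" for m n
    using lift_Suc_mono_le[of G, OF assms(2) that] .
  show ?thesis
  proof
    fix a b c d assume "(a, b) \<in> (\<Union>n. G n)" "(c, d) \<in> (\<Union>n. G n)"
    then obtain m n where "(a, b) \<in> G m" "(c, d) \<in> G n" by auto
    then have "(a, b) \<in> G (max m n)" "(c, d) \<in> G (max m n)"
      using mono[of m "max m n"] mono[of n "max m n"] by auto
    then have "(a - c, b - d) \<in> G (max m n)" "(a * c, b * d) \<in> G (max m n)"
      using partial_embedding.diff[OF pe] partial_embedding.mult[OF pe] by metis+
    then show "(a - c, b - d) \<in> (\<Union>n. G n)" "(a * c, b * d) \<in> (\<Union>n. G n)"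
      by blast+
  next
    show "(1, 1) \<in> (\<Union>n. G n)" using partial_embedding.one[OF pe] by blast
  next
    fix a b assume "(a, b) \<in> (\<Union>n. G n)"
    then show "a = 0 \<longleftrightarrow> b = 0" using partial_embedding.zero_iff[OF pe] by blast
  qed
qed

lemma partial_embedding_of_int:
  assumes "\<And>z. (of_int z :: 'a::comm_ring_1) = 0 \<longleftrightarrow> (of_int z :: 'b::comm_ring_1) = 0"
  shows "partial_embedding (range (\<lambda>z. (of_int z :: 'a, of_int z :: 'b)))"
proof
  let ?f = "\<lambda>z. (of_int z :: 'a, of_int z :: 'b)"
  show "(1, 1) \<in> range ?f"
    by (rule range_eqI[of _ _ 1]) simp
  fix a b c d assume "(a, b) \<in> range ?f" "(c, d) \<in> range ?f"
  then obtain x y where "(a, b) = ?f x" "(c, d) = ?f y" by auto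
  then show "(a - c, b - d) \<in> range ?f" "(a * c, b * d) \<in> range ?f"
    by (auto intro: range_eqI[of _ _ "x - y"] range_eqI[of _ _ "x * y"])
qed (auto simp: assms)

lemma countable_partial_embedding:
  fixes C :: "'a::idom set"
  assumes "countable C" and "uncountable (UNIV :: 'b::alg_closed_field set)"
    and char: "\<And>z. (of_int z :: 'a) = 0 \<longleftrightarrow> (of_int z :: 'b::alg_closed_field) = 0"
  obtains G :: "('a \<times> 'b::alg_closed_field) set" where "partial_embedding G" and "C \<subseteq> Domain G"
proof -
  define s where "s = from_nat_into (insert 0 C)"
  have s: "range s = insert 0 C"
    unfolding s_def using assms(1) by (intro range_from_nat_into) auto
  have "\<exists>G :: nat \<Rightarrow> ('a \<times> 'b) set. \<forall>n. (partial_embedding (G n) \<and> countable (G n)) \<and>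
      G n \<subseteq> G (Suc n) \<and> s n \<in> Domain (G (Suc n))"
  proof (rule dependent_nat_choice)
    show "\<exists>G :: ('a \<times> 'b) set. partial_embedding G \<and> countable G"
      using partial_embedding_of_int[OF char] by (intro exI[of _ "range _"]) auto
  next
    fix G :: "('a \<times> 'b) set" and n
    assume "partial_embedding G \<and> countable G"
    then show "\<exists>H. (partial_embedding H \<and> countable H) \<and> G \<subseteq> H \<and> s n \<in> Domain H"
      using partial_embedding_adjoin[of G "s n"] assms(2) by blast
  qed
  then obtain G :: "nat \<Rightarrow> ('a \<times> 'b) set"
    where G: "\<And>n. partial_embedding (G n)" "\<And>n. G n \<subseteq> G (Suc n)"
      and sG: "\<And>n. s n \<in> Domain (G (Suc n))"
    by blast
  have "C \<subseteq> Domain (\<Union>n. G n)"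
  proof
    fix c assume "c \<in> C"
    then obtain n where "c = s n" using s by blast
    then show "c \<in> Domain (\<Union>n. G n)" using sG[of n] by blast
  qed
  then show ?thesis
    using that partial_embedding_UN_chain[of G] G by blast
qed

lemma field_extension_ring_hom:
  fixes \<iota> :: "'k::field \<Rightarrow> 'f::field"
  assumes "field_extension \<iota>"
  shows "\<iota> 1 = 1" "\<iota> (x - y) = \<iota> x - \<iota> y" "\<iota> (x * y) = \<iota> x * \<iota> y"
    "\<iota> x = 0 \<longleftrightarrow> x = 0" "\<iota> (of_int z) = of_int z"
proof -
  have add: "\<iota> (x + y) = \<iota> x + \<iota> y" for x y
    using assms unfolding field_extension_def by blast
  show one: "\<iota> 1 = 1" and "\<iota> (x * y) = \<iota> x * \<iota> y"
    using assms unfolding field_extension_def by blast+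
  have "\<iota> 0 + \<iota> 0 = \<iota> 0 + 0" using add[of 0 0] by simp
  then have zero: "\<iota> 0 = 0" by (rule add_left_imp_eq)
  then show "\<iota> x = 0 \<longleftrightarrow> x = 0"
    using field_extension_inj[OF assms] by (metis injD)
  have diff: "\<iota> (x - y) = \<iota> x - \<iota> y" for x y
    using add[of "x - y" y] by (simp add: eq_diff_eq)
  then show "\<iota> (x - y) = \<iota> x - \<iota> y" .
  show "\<iota> (of_int z) = of_int z"
    by (induction z rule: int_induct[of _ 0]) (simp_all add: zero one add diff)
qed

text \<open>
  The embedding first goes from \<open>'f1\<close> down to \<open>'k\<close>, where \<open>\<iota>1\<close> guarantees equal
  characteristics, and is then composed with \<open>\<iota>2\<close>.
\<close>

lemma countable_partial_embedding_extension:
  fixes C :: "'f1::field set" and \<iota>1 :: "'k::alg_closed_field \<Rightarrow> 'f1" and \<iota>2 :: "'k \<Rightarrow> 'f2::field"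
  assumes "countable C" and "uncountable (UNIV :: 'k set)"
    and "field_extension \<iota>1" and "field_extension \<iota>2"
  obtains G :: "('f1 \<times> 'f2) set" where "partial_embedding G" and "C \<subseteq> Domain G"
proof -
  note h1 = field_extension_ring_hom[OF assms(3)] and h2 = field_extension_ring_hom[OF assms(4)]
  have "(of_int z :: 'f1) = 0 \<longleftrightarrow> (of_int z :: 'k) = 0" for z
    using h1(4)[of "of_int z"] h1(5)[of z] by simp
  then obtain G :: "('f1 \<times> 'k) set" where G: "partial_embedding G" "C \<subseteq> Domain G"
    using countable_partial_embedding[OF assms(1,2)] by blast
  interpret partial_embedding G by fact
  let ?H = "(\<lambda>(a, b). (a, \<iota>2 b)) ` G"
  have I: "(a, \<iota>2 b) \<in> ?H" if "(a, b) \<in> G" for a b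
    using that by (auto intro: image_eqI[of _ _ "(a, b)"])
  have "partial_embedding ?H"
  proof
    show "(1, 1) \<in> ?H" using I[OF one] by (simp add: h2)
    fix a b c d assume "(a, b) \<in> ?H" "(c, d) \<in> ?H"
    then obtain b' d' where "(a, b') \<in> G" "(c, d') \<in> G" "b = \<iota>2 b'" "d = \<iota>2 d'" by auto
    then show "(a - c, b - d) \<in> ?H" "(a * c, b * d) \<in> ?H"
      using I[OF diff] I[OF mult] by (simp_all flip: h2(2,3))
  next
    fix a b assume "(a, b) \<in> ?H"
    then obtain b' where "(a, b') \<in> G" "b = \<iota>2 b'" by auto
    then show "a = 0 \<longleftrightarrow> b = 0" using zero_iff[of a b'] h2(4) by simp
  qed
  moreover have "C \<subseteq> Domain ?H"
    using G(2) I by blast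
  ultimately show ?thesis by (rule that)
qed

section \<open>Substitution in free algebras\<close>

lemma poly_mapping_decompose:
  fixes p :: "'m \<Rightarrow>\<^sub>0 'r::comm_monoid_add"
  shows "p = (\<Sum>w \<in> Poly_Mapping.keys p. Poly_Mapping.single w (Poly_Mapping.lookup p w))"
  by (rule poly_mapping_eqI)
    (auto simp: lookup_sum lookup_single when_def in_keys_iff)

lemma poly_mapping_induct_single [case_names single add]:
  fixes p :: "'m \<Rightarrow>\<^sub>0 'r::comm_monoid_add"
  assumes single: "\<And>w c. P (Poly_Mapping.single w c)"
    and add: "\<And>p q. P p \<Longrightarrow> P q \<Longrightarrow> P (p + q)"
  shows "P p"
proof -
  have "P 0" using single[of undefined 0] by simp
  then have "P (\<Sum>w \<in> W. Poly_Mapping.single w (Poly_Mapping.lookup p w))" for W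
    by (induction W rule: infinite_finite_induct) (auto intro: single add)
  then show ?thesis by (subst poly_mapping_decompose)
qed

lemma scale_add_left: "scale (a + b) p = scale a p + scale b p"
  by (simp add: scale_eq_single single_add distrib_right)

lemma scale_0_left: "scale 0 p = 0"
  by (simp add: scale_eq_single)

lemma scale_diff_right: "scale c (p - q) = scale c p - scale c q"
  by (simp add: scale_eq_single algebra_simps)

lemma scale_single: "scale c (Poly_Mapping.single w d) = Poly_Mapping.single w (c * d)"
  by (simp add: scale_eq_single mult_single)

lemma scale_scale: "scale a (scale b p) = scale (a * b) p"
  by (simp add: scale_eq_single mult.assoc[symmetric] mult_single)

lemma scale_mult_left: "scale c p * q = scale c (p * q)"
  by (simp add: scale_eq_single mult.assoc)

text \<open>This is where commutativity of the coefficient ring enters.\<close>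

lemma scale_mult_right: "p * scale c q = scale c (p * q)"
proof -
  have "p * Poly_Mapping.single 0 c = Poly_Mapping.single 0 c * p"
    by (induction p rule: poly_mapping_induct_single)
      (simp_all add: mult_single mult.commute distrib_left distrib_right)
  then show ?thesis
    by (simp add: scale_eq_single mult.assoc[symmetric])
qed

text \<open>
  Since the empty word is excluded, every word is a product of generators, and neither the unit nor a
  constant has to be considered.
\<close>

lemma free_algebra_induct [consumes 1, case_names zero gen add scale mult]:
  fixes p :: "('x, 'r::comm_ring_1) free_alg"
  assumes "p \<in> free_algebra X"
    and zero: "P 0" and gen: "\<And>x. x \<in> X \<Longrightarrow> P (gen x)"
    and add: "\<And>p q. p \<in> free_algebra X \<Longrightarrow> q \<in> free_algebra X \<Longrightarrow> P p \<Longrightarrow> P q \<Longrightarrow> P (p + q)"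
    and scale: "\<And>c p. p \<in> free_algebra X \<Longrightarrow> P p \<Longrightarrow> P (scale c p)"
    and mult: "\<And>p q. p \<in> free_algebra X \<Longrightarrow> q \<in> free_algebra X \<Longrightarrow> P p \<Longrightarrow> P q \<Longrightarrow> P (p * q)"
  shows "P p"
proof -
  let ?A = "free_algebra X" and ?m = "\<lambda>xs. Poly_Mapping.single (GWord xs) (1 :: 'r)"
  have word: "?m xs \<in> ?A \<and> P (?m xs)" if "xs \<noteq> []" "set xs \<subseteq> X" for xs
    using that
  proof (induction xs rule: list_nonempty_induct)
    case (single x)
    then show ?case
      using gen[of x] free_algebra_gen[of x X, where 'b = 'r] by (simp add: gen_def)
  next
    case (cons x xs)
    have eq: "?m (x # xs) = gen x * ?m xs"
      by (simp add: gen_def mult_single plus_gword_def)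
    have "x \<in> X" "?m xs \<in> ?A" "P (?m xs)" using cons by auto
    then show ?case
      unfolding eq by (auto intro: mult gen free_algebra_gen free_algebra_mult)
  qed
  have "(\<Sum>w \<in> W. Poly_Mapping.single w (Poly_Mapping.lookup p w)) \<in> ?A \<and>
      P (\<Sum>w \<in> W. Poly_Mapping.single w (Poly_Mapping.lookup p w))"
    if "W \<subseteq> Poly_Mapping.keys p" for W
    using that
  proof (induction W rule: infinite_finite_induct)
    case (insert w W)
    let ?m = "Poly_Mapping.single w (Poly_Mapping.lookup p w)"
    have "letters w \<noteq> []" "set (letters w) \<subseteq> X"
      using insert.prems assms(1) by (auto simp: free_algebra_def)
    then have "Poly_Mapping.single w (1 :: 'r) \<in> ?A" "P (Poly_Mapping.single w 1)"
      using word[of "letters w"] by auto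
    moreover have "?m = scale (Poly_Mapping.lookup p w) (Poly_Mapping.single w 1)"
      by (simp add: scale_single)
    ultimately have "?m \<in> ?A" "P ?m"
      using scale free_algebra_scale by metis+
    then show ?case
      using insert by (auto intro: add free_algebra_add)
  qed (auto intro: zero free_algebra_0)
  then show ?thesis
    using poly_mapping_decompose[of p] by (metis order_refl)
qed

text \<open>
  The algebra homomorphism with values \<open>f\<close> on the generators. It is defined on all words,
  including the empty one, so that it is multiplicative without side conditions.
\<close>

definition subst ::
  "('x \<Rightarrow> ('y, 'r) free_alg) \<Rightarrow> ('x, 'r::comm_ring_1) free_alg \<Rightarrow> ('y, 'r) free_alg" where
  "subst f p = (\<Sum>w \<in> Poly_Mapping.keys p.
    scale (Poly_Mapping.lookup p w) (prod_list (map f (letters w))))"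

lemma subst_single: "subst f (Poly_Mapping.single w c) = scale c (prod_list (map f (letters w)))"
  by (simp add: subst_def scale_0_left)

lemma subst_0: "subst f 0 = 0"
  by (simp add: subst_def)

lemma subst_add: "subst f (p + q) = subst f p + subst f q"
  unfolding subst_def
  by (rule setsum_keys_plus_distrib[of "\<lambda>w c. scale c (prod_list (map f (letters w)))"])
    (simp_all add: scale_0_left scale_add_left)

lemma subst_diff: "subst f (p - q) = subst f p - subst f q"
  using subst_add[of f "p - q" q] by simp

lemma subst_gen: "subst f (gen x) = f x"
  by (simp add: gen_def subst_single scale_eq_single)

lemma subst_mult: "subst f (p * q) = subst f p * subst f q"
proof (induction p rule: poly_mapping_induct_single)
  case (single u c)
  show ?case
  proof (induction q rule: poly_mapping_induct_single)
    case (single v d)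
    show ?case
      by (simp add: mult_single subst_single plus_gword_def scale_mult_left scale_mult_right
          scale_scale mult.commute[of c d])
  qed (simp add: distrib_left subst_add)
qed (simp add: distrib_right subst_add)

lemma subst_scale: "subst f (scale c p) = scale c (subst f p)"
  by (simp add: scale_eq_single subst_mult subst_single zero_gword_def)

lemma subst_in_free_algebra:
  assumes "p \<in> free_algebra X" and f: "\<forall>x \<in> X. f x \<in> free_algebra Y"
  shows "subst f p \<in> free_algebra Y"
  using assms(1)
  by (induction rule: free_algebra_induct)
    (auto simp: subst_0 subst_gen subst_add subst_mult subst_scale f
      intro: free_algebra_0 free_algebra_add free_algebra_mult free_algebra_scale)

section \<open>Isomorphisms of presented algebras\<close>

lemma subst_ideal:
  assumes "p \<in> ideal_generated (free_algebra X) S"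
    and f: "\<forall>x \<in> X. f x \<in> free_algebra Y"
    and S: "\<forall>s \<in> S. subst f s \<in> ideal_generated (free_algebra Y) T"
  shows "subst f p \<in> ideal_generated (free_algebra Y) T"
  using assms(1)
  by induction (use S in \<open>auto simp: subst_0 subst_add subst_mult subst_scale
      intro: ideal_generated.intros subst_in_free_algebra[OF _ f]\<close>)

text \<open>
  A homomorphism that fixes the generators modulo an ideal fixes everything modulo that ideal.
  For a product this is the identity
  \<open>h p * h q - p * q = h p * (h q - q) + (h p - p) * q\<close>.
\<close>

lemma subst_subst_congruent:
  assumes "p \<in> free_algebra X"
    and f: "\<forall>x \<in> X. f x \<in> free_algebra Y" and g: "\<forall>y \<in> Y. g y \<in> free_algebra X"
    and gf: "\<forall>x \<in> X. subst g (f x) - gen x \<in> ideal_generated (free_algebra X) S"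
  shows "subst g (subst f p) - p \<in> ideal_generated (free_algebra X) S"
  using assms(1)
proof (induction rule: free_algebra_induct)
  case (add p q)
  then show ?case
    using ideal_generated.add[OF add.IH] by (simp add: subst_add algebra_simps)
next
  case (scale c p)
  then show ?case
    using ideal_generated.scale[OF scale.IH, of c] by (simp add: subst_scale scale_diff_right)
next
  case (mult p q)
  let ?h = "\<lambda>p. subst g (subst f p)"
  have "?h p \<in> free_algebra X"
    using mult.hyps f g by (intro subst_in_free_algebra)
  then have "?h p * (?h q - q) + (?h p - p) * q \<in> ideal_generated (free_algebra X) S"
    using mult by (auto intro: ideal_generated.intros)
  then show ?case
    by (simp add: subst_mult algebra_simps)
qed (auto simp: subst_0 subst_gen gf intro: ideal_generated.zero)

text \<open>
  The data describing an isomorphism of presented algebras, reduced to elements of free algebras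
  and ideal memberships indexed by generators and relators. Countable presentations thus give
  countably many conditions.
\<close>

definition inverse_substitutions ::
  "'x set \<Rightarrow> ('x, 'r::comm_ring_1) free_alg set \<Rightarrow> 'y set \<Rightarrow> ('y, 'r) free_alg set
    \<Rightarrow> ('x \<Rightarrow> ('y, 'r) free_alg) \<Rightarrow> ('y \<Rightarrow> ('x, 'r) free_alg) \<Rightarrow> bool" where
  "inverse_substitutions X S Y T f g \<longleftrightarrow>
    (\<forall>x \<in> X. f x \<in> free_algebra Y) \<and> (\<forall>y \<in> Y. g y \<in> free_algebra X) \<and>
    (\<forall>s \<in> S. subst f s \<in> ideal_generated (free_algebra Y) T) \<and>
    (\<forall>t \<in> T. subst g t \<in> ideal_generated (free_algebra X) S) \<and>
    (\<forall>x \<in> X. subst g (f x) - gen x \<in> ideal_generated (free_algebra X) S) \<and>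
    (\<forall>y \<in> Y. subst f (g y) - gen y \<in> ideal_generated (free_algebra Y) T)"

abbreviation presented_algebra ::
  "'x set \<Rightarrow> ('x, 'r::comm_ring_1) free_alg set \<Rightarrow> ('r, ('x, 'r) free_alg set) nonunital_algebra"
  where "presented_algebra X S \<equiv>
    quotient_algebra (free_algebra X) (ideal_generated (free_algebra X) S)"

lemma carrier_presented_algebra:
  "carrier (presented_algebra X S) =
    ideal_coset (ideal_generated (free_algebra X) S) ` free_algebra X"
  by (simp add: quotient_algebra_def)

lemma presented_algebra_smult:
  assumes "S \<subseteq> free_algebra X" and "p \<in> free_algebra X"
  shows "alg_smult (presented_algebra X S) c (ideal_coset (ideal_generated (free_algebra X) S) p) =
    ideal_coset (ideal_generated (free_algebra X) S) (scale c p)"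
  by (rule quotient_algebra_ops(3)[OF assms assms(2)])

lemma isomorphic_if_inverse_substitutions:
  assumes S: "S \<subseteq> free_algebra X" and T: "T \<subseteq> free_algebra Y"
    and inv: "inverse_substitutions X S Y T f g"
  shows "algebra_isomorphic (presented_algebra X S) (presented_algebra Y T)"
proof -
  let ?I = "ideal_generated (free_algebra X) S" and ?J = "ideal_generated (free_algebra Y) T"
  have f: "\<forall>x \<in> X. f x \<in> free_algebra Y" and g: "\<forall>y \<in> Y. g y \<in> free_algebra X"
    and fS: "\<forall>s \<in> S. subst f s \<in> ?J" and gT: "\<forall>t \<in> T. subst g t \<in> ?I"
    and gf: "\<forall>x \<in> X. subst g (f x) - gen x \<in> ?I"
    and fg: "\<forall>y \<in> Y. subst f (g y) - gen y \<in> ?J"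
    using inv by (auto simp: inverse_substitutions_def)
  (* Any representative will do, because the substitution maps one ideal into the other. *)
  define rep where "rep P = (SOME p. p \<in> free_algebra X \<and> ideal_coset ?I p = P)" for P
  define \<phi> where "\<phi> P = ideal_coset ?J (subst f (rep P))" for P
  have \<phi>: "\<phi> (ideal_coset ?I p) = ideal_coset ?J (subst f p)" if "p \<in> free_algebra X" for p
  proof -
    have "rep (ideal_coset ?I p) \<in> free_algebra X \<and>
        ideal_coset ?I (rep (ideal_coset ?I p)) = ideal_coset ?I p"
      unfolding rep_def by (rule someI[of _ p]) (use that in simp)
    then have "subst f (rep (ideal_coset ?I p) - p) \<in> ?J"
      using subst_ideal[OF _ f fS] by (simp add: ideal_coset_eq_iff)
    then show ?thesis
      by (simp add: \<phi>_def ideal_coset_eq_iff subst_diff)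
  qed
  have inj: "inj_on \<phi> (carrier (presented_algebra X S))"
  proof (rule inj_onI, unfold carrier_presented_algebra, elim imageE, hypsubst)
    fix p q assume A: "p \<in> free_algebra X" "q \<in> free_algebra X"
      and "\<phi> (ideal_coset ?I p) = \<phi> (ideal_coset ?I q)"
    then have "subst f (p - q) \<in> ?J"
      by (simp add: \<phi> ideal_coset_eq_iff subst_diff)
    then have "subst g (subst f (p - q)) \<in> ?I"
      using subst_ideal[OF _ g gT] by blast
    moreover have "subst g (subst f (p - q)) - (p - q) \<in> ?I"
      using subst_subst_congruent[OF free_algebra_diff[OF A] f g gf] .
    ultimately have "p - q \<in> ?I"
      using ideal_generated_diff by fastforce
    then show "ideal_coset ?I p = ideal_coset ?I q"
      by (simp add: ideal_coset_eq_iff)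
  qed
  have surj: "\<phi> ` carrier (presented_algebra X S) = carrier (presented_algebra Y T)"
  proof
    show "\<phi> ` carrier (presented_algebra X S) \<subseteq> carrier (presented_algebra Y T)"
      unfolding carrier_presented_algebra
      using subst_in_free_algebra[OF _ f] by (auto simp: \<phi>)
    show "carrier (presented_algebra Y T) \<subseteq> \<phi> ` carrier (presented_algebra X S)"
      unfolding carrier_presented_algebra
    proof
      fix Q assume "Q \<in> ideal_coset ?J ` free_algebra Y"
      then obtain q where q: "q \<in> free_algebra Y" "Q = ideal_coset ?J q" by blast
      have "Q = ideal_coset ?J (subst f (subst g q))"
        using ideal_coset_eq_iff subst_subst_congruent[OF q(1) g f fg] q(2) by metis
      then show "Q \<in> \<phi> ` ideal_coset ?I ` free_algebra X"
        using \<phi> subst_in_free_algebra[OF q(1) g] by auto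
    qed
  qed
  have hom: "\<phi> (alg_add (presented_algebra X S) P Q) =
        alg_add (presented_algebra Y T) (\<phi> P) (\<phi> Q)"
      "\<phi> (alg_mult (presented_algebra X S) P Q) =
        alg_mult (presented_algebra Y T) (\<phi> P) (\<phi> Q)"
      "\<phi> (alg_smult (presented_algebra X S) c P) = alg_smult (presented_algebra Y T) c (\<phi> P)"
    if "P \<in> carrier (presented_algebra X S)" "Q \<in> carrier (presented_algebra X S)" for P Q c
  proof -
    obtain p q where "p \<in> free_algebra X" "P = ideal_coset ?I p"
      "q \<in> free_algebra X" "Q = ideal_coset ?I q"
      using \<open>P \<in> _\<close> \<open>Q \<in> _\<close> unfolding carrier_presented_algebra by blast
    then show "\<phi> (alg_add (presented_algebra X S) P Q) =
        alg_add (presented_algebra Y T) (\<phi> P) (\<phi> Q)"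
      "\<phi> (alg_mult (presented_algebra X S) P Q) =
        alg_mult (presented_algebra Y T) (\<phi> P) (\<phi> Q)"
      "\<phi> (alg_smult (presented_algebra X S) c P) = alg_smult (presented_algebra Y T) c (\<phi> P)"
      using subst_in_free_algebra[OF _ f]
      by (simp_all add: quotient_algebra_ops(1,2)[OF S] quotient_algebra_ops(1,2)[OF T]
          presented_algebra_smult[OF S] presented_algebra_smult[OF T] \<phi>
          free_algebra_add free_algebra_mult free_algebra_scale subst_add subst_mult subst_scale)
  qed
  show ?thesis
    unfolding algebra_isomorphic_def
  proof (intro exI[of _ \<phi>] conjI ballI allI)
    show "bij_betw \<phi> (carrier (presented_algebra X S)) (carrier (presented_algebra Y T))"
      using inj surj by (simp add: bij_betw_def)
  next
    fix c P assume P: "P \<in> carrier (presented_algebra X S)"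
    show "\<phi> (alg_smult (presented_algebra X S) c P) =
        alg_smult (presented_algebra Y T) c (\<phi> P)"
      using hom(3)[OF P P] .
  qed (rule hom(1) hom(2); assumption)+
qed

text \<open>
  The substitution \<open>f\<close> lifts the isomorphism \<open>\<phi>\<close>, so its conditions follow by applying \<open>\<phi>\<close>. The
  substitution \<open>g\<close> is known only through its values on generators, chosen as preimages;
  its conditions follow from injectivity of \<open>\<phi>\<close> after applying \<open>\<phi>\<close> to both sides.
\<close>

lemma inverse_substitutions_if_isomorphic:
  assumes S: "S \<subseteq> free_algebra X" and T: "T \<subseteq> free_algebra Y"
    and iso: "algebra_isomorphic (presented_algebra X S) (presented_algebra Y T)"
  shows "\<exists>f g. inverse_substitutions X S Y T f g"
proof -
  let ?I = "ideal_generated (free_algebra X) S" and ?J = "ideal_generated (free_algebra Y) T"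
  let ?A = "presented_algebra X S" and ?B = "presented_algebra Y T"
  obtain \<phi> where bij: "bij_betw \<phi> (carrier ?A) (carrier ?B)"
    and \<phi>_add: "\<And>P Q. P \<in> carrier ?A \<Longrightarrow> Q \<in> carrier ?A
      \<Longrightarrow> \<phi> (alg_add ?A P Q) = alg_add ?B (\<phi> P) (\<phi> Q)"
    and \<phi>_mult: "\<And>P Q. P \<in> carrier ?A \<Longrightarrow> Q \<in> carrier ?A
      \<Longrightarrow> \<phi> (alg_mult ?A P Q) = alg_mult ?B (\<phi> P) (\<phi> Q)"
    and \<phi>_smult: "\<And>c P. P \<in> carrier ?A \<Longrightarrow> \<phi> (alg_smult ?A c P) = alg_smult ?B c (\<phi> P)"
    using iso unfolding algebra_isomorphic_def by blast
  have inA: "ideal_coset ?I p \<in> carrier ?A" if "p \<in> free_algebra X" for p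
    using that by (simp add: carrier_presented_algebra)
  have lift: "\<exists>q. q \<in> free_algebra Y \<and> \<phi> (ideal_coset ?I p) = ideal_coset ?J q"
    if "p \<in> free_algebra X" for p
    using bij_betwE[OF bij, rule_format, OF inA[OF that]] by (auto simp: carrier_presented_algebra)
  have inj: "p - q \<in> ?I"
    if "p \<in> free_algebra X" "q \<in> free_algebra X" "\<phi> (ideal_coset ?I p) = \<phi> (ideal_coset ?I q)"
    for p q
    using inj_onD[OF bij_betw_imp_inj_on[OF bij] that(3) inA[OF that(1)] inA[OF that(2)]]
    by (simp add: ideal_coset_eq_iff)
  have "\<forall>x \<in> X. \<exists>q. q \<in> free_algebra Y \<and> \<phi> (ideal_coset ?I (gen x)) = ideal_coset ?J q"
    using lift[OF free_algebra_gen] by simp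
  then obtain f where f: "\<forall>x \<in> X. f x \<in> free_algebra Y"
    and \<phi>gen: "\<And>x. x \<in> X \<Longrightarrow> \<phi> (ideal_coset ?I (gen x)) = ideal_coset ?J (f x)"
    by metis
  have "\<forall>y \<in> Y. \<exists>p. p \<in> free_algebra X \<and> \<phi> (ideal_coset ?I p) = ideal_coset ?J (gen y)"
  proof
    fix y assume "y \<in> Y"
    then have "ideal_coset ?J (gen y) \<in> carrier ?B"
      by (simp add: carrier_presented_algebra free_algebra_gen)
    then have "ideal_coset ?J (gen y) \<in> \<phi> ` carrier ?A"
      by (simp only: bij_betw_imp_surj_on[OF bij])
    then obtain P where "P \<in> carrier ?A" and P: "\<phi> P = ideal_coset ?J (gen y)"
      by (metis imageE)
    then obtain p where "p \<in> free_algebra X" "P = ideal_coset ?I p"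
      unfolding carrier_presented_algebra by blast
    with P show "\<exists>p. p \<in> free_algebra X \<and> \<phi> (ideal_coset ?I p) = ideal_coset ?J (gen y)"
      by blast
  qed
  then obtain g where g: "\<forall>y \<in> Y. g y \<in> free_algebra X"
    and \<phi>g: "\<And>y. y \<in> Y \<Longrightarrow> \<phi> (ideal_coset ?I (g y)) = ideal_coset ?J (gen y)"
    by metis
  have \<phi>: "\<phi> (ideal_coset ?I p) = ideal_coset ?J (subst f p)" if "p \<in> free_algebra X" for p
    using that
  proof (induction rule: free_algebra_induct)
    case zero
    obtain q where q: "q \<in> free_algebra Y" "\<phi> (ideal_coset ?I 0) = ideal_coset ?J q"
      using lift[OF free_algebra_0] by blast
    (* Preservation of zero is not part of the definition of an isomorphism; it follows from
       compatibility with the scalar 0. *)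
    have "\<phi> (ideal_coset ?I 0) = \<phi> (alg_smult ?A 0 (ideal_coset ?I 0))"
      by (simp add: presented_algebra_smult[OF S] free_algebra_0 scale_0_left)
    also have "\<dots> = ideal_coset ?J 0"
      using q by (simp add: \<phi>_smult inA free_algebra_0 presented_algebra_smult[OF T] scale_0_left)
    finally show ?case by (simp add: subst_0)
  next
    case (gen x)
    then show ?case by (simp add: \<phi>gen subst_gen)
  next
    case (add p q)
    then show ?case
      using assms(1,2) subst_in_free_algebra[OF _ f] \<phi>_add[OF inA inA, of p q]
      by (simp add: quotient_algebra_ops(1) subst_add)
  next
    case (scale c p)
    then show ?case
      using assms(1,2) subst_in_free_algebra[OF _ f] \<phi>_smult[OF inA, of p c]
      by (simp add: presented_algebra_smult subst_scale)
  next
    case (mult p q)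
    then show ?case
      using assms(1,2) subst_in_free_algebra[OF _ f] \<phi>_mult[OF inA inA, of p q]
      by (simp add: quotient_algebra_ops(2) subst_mult)
  qed
  have fS: "subst f s \<in> ?J" if "s \<in> S" for s
  proof -
    have "s \<in> free_algebra X" "ideal_coset ?I s = ideal_coset ?I 0"
      using that S by (auto simp: ideal_coset_eq_iff intro: ideal_generated.base)
    then have "ideal_coset ?J (subst f s) = ideal_coset ?J 0"
      using \<phi>[of s] \<phi>[of 0] by (simp add: subst_0 free_algebra_0)
    then show ?thesis by (simp add: ideal_coset_eq_iff)
  qed
  have fg: "\<forall>y \<in> Y. subst f (g y) - gen y \<in> ?J"
  proof
    fix y assume "y \<in> Y"
    then have "ideal_coset ?J (subst f (g y)) = ideal_coset ?J (gen y)"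
      using \<phi>[of "g y"] \<phi>g[of y] g by simp
    then show "subst f (g y) - gen y \<in> ?J" by (simp only: ideal_coset_eq_iff)
  qed
  have \<phi>_subst_g: "\<phi> (ideal_coset ?I (subst g q)) = ideal_coset ?J q" if "q \<in> free_algebra Y" for q
    using \<phi>[OF subst_in_free_algebra[OF that g]] subst_subst_congruent[OF that g f fg]
    by (simp add: ideal_coset_eq_iff)
  have gT: "subst g t \<in> ?I" if "t \<in> T" for t
  proof -
    have t: "t \<in> free_algebra Y" "ideal_coset ?J t = ideal_coset ?J 0"
      using that T by (auto simp: ideal_coset_eq_iff intro: ideal_generated.base)
    then have "\<phi> (ideal_coset ?I (subst g t)) = \<phi> (ideal_coset ?I 0)"
      using \<phi>_subst_g[of t] \<phi>[OF free_algebra_0] by (simp add: subst_0)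
    then show ?thesis
      using inj[OF subst_in_free_algebra[OF t(1) g] free_algebra_0] by simp
  qed
  have gf: "subst g (f x) - gen x \<in> ?I" if "x \<in> X" for x
  proof (rule inj)
    show "\<phi> (ideal_coset ?I (subst g (f x))) = \<phi> (ideal_coset ?I (gen x))"
      using \<phi>_subst_g \<phi>gen f that by simp
  qed (use that f g in \<open>auto intro: subst_in_free_algebra free_algebra_gen\<close>)
  show ?thesis
    unfolding inverse_substitutions_def using f g fS gT gf fg by blast
qed

section \<open>Change of coefficients along a partial embedding\<close>

text \<open>
  The relation of elements to their images under the ring homomorphism with graph \<open>G\<close>, applied to
  the coefficients. As a relation it is compatible with the operations even where that
  homomorphism is not defined everywhere.
\<close>

definition free_alg_rel ::
  "('r::comm_ring_1 \<times> 's::comm_ring_1) set \<Rightarrow> ('x, 'r) free_alg \<Rightarrow> ('x, 's) free_alg \<Rightarrow> bool" where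
  "free_alg_rel G p q \<longleftrightarrow> (\<forall>w. (Poly_Mapping.lookup p w, Poly_Mapping.lookup q w) \<in> G)"

lemma free_alg_rel_converse: "free_alg_rel (G\<inverse>) q p \<longleftrightarrow> free_alg_rel G p q"
  by (simp add: free_alg_rel_def)

context partial_embedding
begin

lemma free_alg_rel_keys:
  assumes "free_alg_rel G p q"
  shows "Poly_Mapping.keys p = Poly_Mapping.keys q"
proof -
  have "w \<in> Poly_Mapping.keys p \<longleftrightarrow> w \<in> Poly_Mapping.keys q" for w
    using assms zero_iff[of "Poly_Mapping.lookup p w" "Poly_Mapping.lookup q w"]
    by (simp add: free_alg_rel_def in_keys_iff)
  then show ?thesis by blast
qed

lemma free_alg_rel_free_algebra:
  "free_alg_rel G p q \<Longrightarrow> p \<in> free_algebra X \<longleftrightarrow> q \<in> free_algebra X"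
  by (simp add: free_algebra_def free_alg_rel_keys)

lemma free_alg_rel_unique: "free_alg_rel G p q \<Longrightarrow> free_alg_rel G p q' \<Longrightarrow> q = q'"
  unfolding free_alg_rel_def by (rule poly_mapping_eqI) (blast intro: unique)

lemma free_alg_rel_0: "free_alg_rel G 0 0"
  by (simp add: free_alg_rel_def zero)

lemma free_alg_rel_add:
  "free_alg_rel G p q \<Longrightarrow> free_alg_rel G p' q' \<Longrightarrow> free_alg_rel G (p + p') (q + q')"
  by (simp add: free_alg_rel_def lookup_add add)

lemma free_alg_rel_diff:
  "free_alg_rel G p q \<Longrightarrow> free_alg_rel G p' q' \<Longrightarrow> free_alg_rel G (p - p') (q - q')"
  by (simp add: free_alg_rel_def lookup_minus diff)

lemma free_alg_rel_sum:
  "(\<And>i. i \<in> I \<Longrightarrow> free_alg_rel G (f i) (g i)) \<Longrightarrow> free_alg_rel G (sum f I) (sum g I)"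
  by (induction I rule: infinite_finite_induct) (auto intro: free_alg_rel_0 free_alg_rel_add)

lemma free_alg_rel_single:
  "(c, d) \<in> G \<Longrightarrow> free_alg_rel G (Poly_Mapping.single w c) (Poly_Mapping.single w d)"
  by (simp add: free_alg_rel_def lookup_single when_def zero)

lemma free_alg_rel_gen: "free_alg_rel G (gen x) (gen x)"
  unfolding gen_def by (rule free_alg_rel_single) (rule one)

text \<open>
  Related elements have the same support, so the two products expand into sums over the same pairs of
  words.
\<close>

lemma free_alg_rel_mult:
  assumes "free_alg_rel G p q" and "free_alg_rel G p' q'"
  shows "free_alg_rel G (p * p') (q * q')"
proof -
  have eq: "a * b = (\<Sum>u \<in> Poly_Mapping.keys a. \<Sum>v \<in> Poly_Mapping.keys b.
      Poly_Mapping.single (u + v) (Poly_Mapping.lookup a u * Poly_Mapping.lookup b v))"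
    for a b :: "('x, 'r::comm_ring_1) free_alg"
  proof -
    have "a * b =
        (\<Sum>u \<in> Poly_Mapping.keys a. Poly_Mapping.single u (Poly_Mapping.lookup a u)) *
        (\<Sum>v \<in> Poly_Mapping.keys b. Poly_Mapping.single v (Poly_Mapping.lookup b v))"
      by (rule arg_cong2[OF poly_mapping_decompose poly_mapping_decompose])
    then show ?thesis by (simp only: sum_product mult_single)
  qed
  show ?thesis
    unfolding eq[of p p'] eq[of q q'] free_alg_rel_keys[OF assms(1)] free_alg_rel_keys[OF assms(2)]
    using assms by (intro free_alg_rel_sum free_alg_rel_single mult) (simp_all add: free_alg_rel_def)
qed

lemma free_alg_rel_scale:
  "(c, d) \<in> G \<Longrightarrow> free_alg_rel G p q \<Longrightarrow> free_alg_rel G (scale c p) (scale d q)"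
  unfolding scale_eq_single by (intro free_alg_rel_mult free_alg_rel_single)

lemma free_alg_rel_prod_list:
  assumes "\<And>x. x \<in> set xs \<Longrightarrow> free_alg_rel G (f x) (g x)"
  shows "free_alg_rel G (prod_list (map f xs)) (prod_list (map g xs))"
  using assms
proof (induction xs)
  case Nil
  have "free_alg_rel G (Poly_Mapping.single 0 1) (Poly_Mapping.single 0 1)"
    using one by (rule free_alg_rel_single)
  then show ?case by simp
qed (auto intro: free_alg_rel_mult)

lemma free_alg_rel_subst:
  assumes "free_alg_rel G p q" and "p \<in> free_algebra X"
    and f: "\<And>x. x \<in> X \<Longrightarrow> free_alg_rel G (f x) (g x)"
  shows "free_alg_rel G (subst f p) (subst g q)"
  unfolding subst_def free_alg_rel_keys[OF assms(1)]
proof (intro free_alg_rel_sum free_alg_rel_scale free_alg_rel_prod_list)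
  fix w x assume "w \<in> Poly_Mapping.keys q" "x \<in> set (letters w)"
  then show "free_alg_rel G (f x) (g x)"
    using assms(2) free_alg_rel_keys[OF assms(1)] f by (auto simp: free_algebra_def)
qed (use assms(1) in \<open>simp add: free_alg_rel_def\<close>)

lemma free_alg_rel_exists:
  assumes "Poly_Mapping.lookup p ` Poly_Mapping.keys p \<subseteq> Domain G"
  shows "\<exists>q. free_alg_rel G p q"
proof -
  define h where "h c = (if c = 0 then 0 else SOME d. (c, d) \<in> G)" for c
  have h: "(c, h c) \<in> G" if "c = 0 \<or> c \<in> Domain G" for c
    using that zero by (auto simp: h_def intro: someI)
  have "Poly_Mapping.lookup (Poly_Mapping.map h p) w = h (Poly_Mapping.lookup p w)" for w
    by (simp add: map.rep_eq when_def h_def)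
  moreover have "Poly_Mapping.lookup p w = 0 \<or> Poly_Mapping.lookup p w \<in> Domain G" for w
    using assms by (metis image_subset_iff in_keys_iff)
  ultimately have "free_alg_rel G p (Poly_Mapping.map h p)"
    unfolding free_alg_rel_def using h by simp
  then show ?thesis ..
qed

end

text \<open>
  The set \<open>C\<close> collects the scalars occurring in one derivation of \<open>p\<close> from the relators. As soon as
  all of them have an image under \<open>G\<close>, the derivation can be repeated over the other ring.
\<close>

lemma ideal_membership_transfer:
  fixes S :: "('x, 'r::comm_ring_1) free_alg set" and S' :: "('x, 's::comm_ring_1) free_alg set"
  assumes "p \<in> ideal_generated (free_algebra X) S"
  shows "\<exists>C. finite C \<and> (\<forall>G. partial_embedding G \<longrightarrow> C \<subseteq> Domain G \<longrightarrow>
    rel_set (free_alg_rel G) S S' \<longrightarrow>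
    (\<exists>q \<in> ideal_generated (free_algebra X) S'. free_alg_rel G p q))"
  using assms
proof induction
  case (base p)
  then show ?case
    by (intro exI[of _ "{}"]) (auto dest!: rel_setD1 intro: ideal_generated.base)
next
  case zero
  then show ?case
    by (intro exI[of _ "{}"])
      (auto intro: partial_embedding.free_alg_rel_0 ideal_generated.zero)
next
  case (add p q)
  then obtain C D where "finite C" "finite D" and
    C: "\<And>G. partial_embedding G \<Longrightarrow> C \<subseteq> Domain G \<Longrightarrow> rel_set (free_alg_rel G) S S' \<Longrightarrow>
      \<exists>q \<in> ideal_generated (free_algebra X) S'. free_alg_rel G p q" and
    D: "\<And>G. partial_embedding G \<Longrightarrow> D \<subseteq> Domain G \<Longrightarrow> rel_set (free_alg_rel G) S S' \<Longrightarrow>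
      \<exists>q' \<in> ideal_generated (free_algebra X) S'. free_alg_rel G q q'"
    by blast
  show ?case
  proof (intro exI[of _ "C \<union> D"] conjI allI impI)
    fix G :: "('r \<times> 's) set"
    assume G: "partial_embedding G" "C \<union> D \<subseteq> Domain G" "rel_set (free_alg_rel G) S S'"
    then obtain p' q' where "p' \<in> ideal_generated (free_algebra X) S'" "free_alg_rel G p p'"
      "q' \<in> ideal_generated (free_algebra X) S'" "free_alg_rel G q q'"
      using C[of G] D[of G] by auto
    then show "\<exists>r \<in> ideal_generated (free_algebra X) S'. free_alg_rel G (p + q) r"
      using partial_embedding.free_alg_rel_add[OF G(1)] ideal_generated.add by blast
  qed (use \<open>finite C\<close> \<open>finite D\<close> in simp)
next
  case (scale p c)
  then obtain C where "finite C" and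
    C: "\<And>G. partial_embedding G \<Longrightarrow> C \<subseteq> Domain G \<Longrightarrow> rel_set (free_alg_rel G) S S' \<Longrightarrow>
      \<exists>q \<in> ideal_generated (free_algebra X) S'. free_alg_rel G p q"
    by blast
  show ?case
  proof (intro exI[of _ "insert c C"] conjI allI impI)
    fix G :: "('r \<times> 's) set"
    assume G: "partial_embedding G" "insert c C \<subseteq> Domain G" "rel_set (free_alg_rel G) S S'"
    then obtain p' d where "p' \<in> ideal_generated (free_algebra X) S'" "free_alg_rel G p p'"
      "(c, d) \<in> G"
      using C[of G] by auto
    then show "\<exists>r \<in> ideal_generated (free_algebra X) S'. free_alg_rel G (scale c p) r"
      using partial_embedding.free_alg_rel_scale[OF G(1)] ideal_generated.scale by blast
  qed (use \<open>finite C\<close> in simp)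
next
  case (mult_left a p)
  then obtain C where "finite C" and
    C: "\<And>G. partial_embedding G \<Longrightarrow> C \<subseteq> Domain G \<Longrightarrow> rel_set (free_alg_rel G) S S' \<Longrightarrow>
      \<exists>q \<in> ideal_generated (free_algebra X) S'. free_alg_rel G p q"
    by blast
  let ?D = "Poly_Mapping.lookup a ` Poly_Mapping.keys a"
  show ?case
  proof (intro exI[of _ "?D \<union> C"] conjI allI impI)
    fix G :: "('r \<times> 's) set"
    assume G: "partial_embedding G" "?D \<union> C \<subseteq> Domain G" "rel_set (free_alg_rel G) S S'"
    then obtain p' where p': "p' \<in> ideal_generated (free_algebra X) S'" "free_alg_rel G p p'"
      using C[of G] by auto
    obtain a' where a': "free_alg_rel G a a'"
      using partial_embedding.free_alg_rel_exists[OF G(1), of a] G(2) by auto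
    then have "a' \<in> free_algebra X"
      using partial_embedding.free_alg_rel_free_algebra[OF G(1)] mult_left.hyps by blast
    then show "\<exists>r \<in> ideal_generated (free_algebra X) S'. free_alg_rel G (a * p) r"
      using partial_embedding.free_alg_rel_mult[OF G(1)] p' a' ideal_generated.mult_left by blast
  qed (use \<open>finite C\<close> in simp)
next
  case (mult_right a p)
  then obtain C where "finite C" and
    C: "\<And>G. partial_embedding G \<Longrightarrow> C \<subseteq> Domain G \<Longrightarrow> rel_set (free_alg_rel G) S S' \<Longrightarrow>
      \<exists>q \<in> ideal_generated (free_algebra X) S'. free_alg_rel G p q"
    by blast
  let ?D = "Poly_Mapping.lookup a ` Poly_Mapping.keys a"
  show ?case
  proof (intro exI[of _ "?D \<union> C"] conjI allI impI)
    fix G :: "('r \<times> 's) set"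
    assume G: "partial_embedding G" "?D \<union> C \<subseteq> Domain G" "rel_set (free_alg_rel G) S S'"
    then obtain p' where p': "p' \<in> ideal_generated (free_algebra X) S'" "free_alg_rel G p p'"
      using C[of G] by auto
    obtain a' where a': "free_alg_rel G a a'"
      using partial_embedding.free_alg_rel_exists[OF G(1), of a] G(2) by auto
    then have "a' \<in> free_algebra X"
      using partial_embedding.free_alg_rel_free_algebra[OF G(1)] mult_right.hyps by blast
    then show "\<exists>r \<in> ideal_generated (free_algebra X) S'. free_alg_rel G (p * a) r"
      using partial_embedding.free_alg_rel_mult[OF G(1)] p' a' ideal_generated.mult_right by blast
  qed (use \<open>finite C\<close> in simp)
qed

text \<open>
  A choice of \<open>C\<close> for every \<open>p\<close> at once; since \<open>G\<close> is single-valued, the related element that lies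
  in the ideal is the given \<open>q\<close>.
\<close>

lemma ideal_membership_witnesses:
  fixes S :: "('x, 'r::comm_ring_1) free_alg set" and S' :: "('x, 's::comm_ring_1) free_alg set"
  obtains C where "\<And>p. finite (C p)"
    and "\<And>G p q. partial_embedding G \<Longrightarrow> rel_set (free_alg_rel G) S S' \<Longrightarrow>
      p \<in> ideal_generated (free_algebra X) S \<Longrightarrow> C p \<subseteq> Domain G \<Longrightarrow> free_alg_rel G p q \<Longrightarrow>
      q \<in> ideal_generated (free_algebra X) S'"
proof -
  let ?Q = "\<lambda>p C. finite C \<and> (\<forall>G. partial_embedding G \<longrightarrow> C \<subseteq> Domain G \<longrightarrow>
    rel_set (free_alg_rel G) S S' \<longrightarrow>
    (\<exists>q \<in> ideal_generated (free_algebra X) S'. free_alg_rel G p q))"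
  have "\<forall>p. \<exists>C. finite C \<and> (p \<in> ideal_generated (free_algebra X) S \<longrightarrow> ?Q p C)"
    using ideal_membership_transfer[of _ X S S'] by (metis finite.emptyI)
  then obtain C where C: "\<And>p. finite (C p)"
    "\<And>p. p \<in> ideal_generated (free_algebra X) S \<Longrightarrow> ?Q p (C p)"
    by metis
  show ?thesis
  proof (rule that[OF C(1)])
    fix G p q
    assume G: "partial_embedding G" "rel_set (free_alg_rel G) S S'"
      "p \<in> ideal_generated (free_algebra X) S" "C p \<subseteq> Domain G" "free_alg_rel G p q"
    then obtain q' where "q' \<in> ideal_generated (free_algebra X) S'" "free_alg_rel G p q'"
      using C(2) by blast
    then show "q \<in> ideal_generated (free_algebra X) S'"
      using partial_embedding.free_alg_rel_unique[OF G(1,5)] by simp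
  qed
qed

text \<open>
  The set \<open>C\<close> contains the coefficients of the lifts together with the scalars that witness all
  the ideal memberships. It is countable because each generator and each relator contributes
  finitely many elements.
\<close>

lemma inverse_substitutions_transfer:
  fixes S :: "('x, 'r::comm_ring_1) free_alg set" and S' :: "('x, 's::comm_ring_1) free_alg set"
    and T :: "('y, 'r) free_alg set" and T' :: "('y, 's) free_alg set"
  assumes cnt: "countable X" "countable Y" "countable S" "countable T"
    and S: "S \<subseteq> free_algebra X" and T: "T \<subseteq> free_algebra Y"
    and inv: "inverse_substitutions X S Y T f g"
  obtains C where "countable C"
    and "\<And>G :: ('r \<times> 's) set. partial_embedding G \<Longrightarrow> C \<subseteq> Domain G \<Longrightarrow>
      rel_set (free_alg_rel G) S S' \<Longrightarrow> rel_set (free_alg_rel G) T T' \<Longrightarrow>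
      \<exists>f' g'. inverse_substitutions X S' Y T' f' g'"
proof -
  let ?I = "ideal_generated (free_algebra X) S" and ?J = "ideal_generated (free_algebra Y) T"
  have f: "\<And>x. x \<in> X \<Longrightarrow> f x \<in> free_algebra Y" and g: "\<And>y. y \<in> Y \<Longrightarrow> g y \<in> free_algebra X"
    and fS: "\<And>s. s \<in> S \<Longrightarrow> subst f s \<in> ?J" and gT: "\<And>t. t \<in> T \<Longrightarrow> subst g t \<in> ?I"
    and gf: "\<And>x. x \<in> X \<Longrightarrow> subst g (f x) - gen x \<in> ?I"
    and fg: "\<And>y. y \<in> Y \<Longrightarrow> subst f (g y) - gen y \<in> ?J"
    using inv by (auto simp: inverse_substitutions_def)
  obtain C where C: "\<And>p. finite (C p)"
    "\<And>G p q. partial_embedding G \<Longrightarrow> rel_set (free_alg_rel G) S S' \<Longrightarrow> p \<in> ?I \<Longrightarrow>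
      C p \<subseteq> Domain G \<Longrightarrow> free_alg_rel G p q \<Longrightarrow> q \<in> ideal_generated (free_algebra X) S'"
    using ideal_membership_witnesses[of S S' X] by blast
  obtain D where D: "\<And>p. finite (D p)"
    "\<And>G p q. partial_embedding G \<Longrightarrow> rel_set (free_alg_rel G) T T' \<Longrightarrow> p \<in> ?J \<Longrightarrow>
      D p \<subseteq> Domain G \<Longrightarrow> free_alg_rel G p q \<Longrightarrow> q \<in> ideal_generated (free_algebra Y) T'"
    using ideal_membership_witnesses[of T T' Y] by blast
  define W where "W =
    (\<Union>x \<in> X. Poly_Mapping.lookup (f x) ` Poly_Mapping.keys (f x) \<union> C (subst g (f x) - gen x)) \<union>
    (\<Union>y \<in> Y. Poly_Mapping.lookup (g y) ` Poly_Mapping.keys (g y) \<union> D (subst f (g y) - gen y)) \<union>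
    (\<Union>s \<in> S. D (subst f s)) \<union> (\<Union>t \<in> T. C (subst g t))"
  show ?thesis
  proof (rule that)
    show "countable W"
      unfolding W_def using cnt C(1) D(1) by (simp add: countable_UN countable_finite)
  next
    fix G :: "('r \<times> 's) set"
    assume pe: "partial_embedding G" and WG: "W \<subseteq> Domain G"
      and SS: "rel_set (free_alg_rel G) S S'" and TT: "rel_set (free_alg_rel G) T T'"
    interpret partial_embedding G by fact
    have WX: "Poly_Mapping.lookup (f x) ` Poly_Mapping.keys (f x) \<subseteq> Domain G"
      "C (subst g (f x) - gen x) \<subseteq> Domain G" if "x \<in> X" for x
      using WG that unfolding W_def Un_subset_iff UN_subset_iff by simp_all
    have WY: "Poly_Mapping.lookup (g y) ` Poly_Mapping.keys (g y) \<subseteq> Domain G"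
      "D (subst f (g y) - gen y) \<subseteq> Domain G" if "y \<in> Y" for y
      using WG that unfolding W_def Un_subset_iff UN_subset_iff by simp_all
    have WS: "D (subst f s) \<subseteq> Domain G" if "s \<in> S" for s
      using WG that unfolding W_def Un_subset_iff UN_subset_iff by simp
    have WT: "C (subst g t) \<subseteq> Domain G" if "t \<in> T" for t
      using WG that unfolding W_def Un_subset_iff UN_subset_iff by simp
    have "\<exists>q. free_alg_rel G (f x) q" if "x \<in> X" for x
      using WX(1)[OF that] by (rule free_alg_rel_exists)
    then obtain f' where f': "\<And>x. x \<in> X \<Longrightarrow> free_alg_rel G (f x) (f' x)" by metis
    have "\<exists>q. free_alg_rel G (g y) q" if "y \<in> Y" for y
      using WY(1)[OF that] by (rule free_alg_rel_exists)
    then obtain g' where g': "\<And>y. y \<in> Y \<Longrightarrow> free_alg_rel G (g y) (g' y)" by metis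
    have "inverse_substitutions X S' Y T' f' g'"
      unfolding inverse_substitutions_def
    proof (intro conjI ballI)
      fix x assume x: "x \<in> X"
      show "f' x \<in> free_algebra Y"
        using free_alg_rel_free_algebra[OF f'[OF x]] f[OF x] by blast
      have "free_alg_rel G (subst g (f x) - gen x) (subst g' (f' x) - gen x)"
        using f'[OF x] f[OF x] g' by (intro free_alg_rel_diff free_alg_rel_subst free_alg_rel_gen)
      then show "subst g' (f' x) - gen x \<in> ideal_generated (free_algebra X) S'"
        by (rule C(2)[OF pe SS gf[OF x] WX(2)[OF x]])
    next
      fix y assume y: "y \<in> Y"
      show "g' y \<in> free_algebra X"
        using free_alg_rel_free_algebra[OF g'[OF y]] g[OF y] by blast
      have "free_alg_rel G (subst f (g y) - gen y) (subst f' (g' y) - gen y)"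
        using g'[OF y] g[OF y] f' by (intro free_alg_rel_diff free_alg_rel_subst free_alg_rel_gen)
      then show "subst f' (g' y) - gen y \<in> ideal_generated (free_algebra Y) T'"
        by (rule D(2)[OF pe TT fg[OF y] WY(2)[OF y]])
    next
      fix s' assume "s' \<in> S'"
      then obtain s where s: "s \<in> S" "free_alg_rel G s s'" using rel_setD2[OF SS] by blast
      have "free_alg_rel G (subst f s) (subst f' s')"
        using s S f' by (intro free_alg_rel_subst) auto
      then show "subst f' s' \<in> ideal_generated (free_algebra Y) T'"
        by (rule D(2)[OF pe TT fS[OF s(1)] WS[OF s(1)]])
    next
      fix t' assume "t' \<in> T'"
      then obtain t where t: "t \<in> T" "free_alg_rel G t t'" using rel_setD2[OF TT] by blast
      have "free_alg_rel G (subst g t) (subst g' t')"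
        using t T g' by (intro free_alg_rel_subst) auto
      then show "subst g' t' \<in> ideal_generated (free_algebra X) S'"
        by (rule C(2)[OF pe SS gT[OF t(1)] WT[OF t(1)]])
    qed
    then show "\<exists>f' g'. inverse_substitutions X S' Y T' f' g'" by blast
  qed
qed

section \<open>Leavitt path algebras over different fields\<close>

text \<open>
  The relators are integer combinations of words, and a subring of \<open>'a \<times> 'b\<close> contains the pairs of
  corresponding integers.
\<close>

lemma (in partial_embedding) lpa_relators_rel:
  assumes "p \<in> lpa_relators E"
  shows "\<exists>q \<in> lpa_relators E. free_alg_rel G p q"
  using assms
proof cases
  case (V v w)
  have "free_alg_rel G p (gen (Vertex v) * gen (Vertex w) - (if v = w then gen (Vertex v) else 0))"
    unfolding V(1)
    by (auto intro: free_alg_rel_diff free_alg_rel_mult free_alg_rel_gen free_alg_rel_0)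
  then show ?thesis using lpa_relators.V[OF V(2,3)] by (rule bexI)
next
  case (E1_source e)
  have "free_alg_rel G p (gen (Vertex (tail E e)) * gen (Edge e) - gen (Edge e))"
    unfolding E1_source(1) by (intro free_alg_rel_diff free_alg_rel_mult free_alg_rel_gen)
  then show ?thesis using lpa_relators.E1_source[OF E1_source(2)] by (rule bexI)
next
  case (E1_range e)
  have "free_alg_rel G p (gen (Edge e) * gen (Vertex (head E e)) - gen (Edge e))"
    unfolding E1_range(1) by (intro free_alg_rel_diff free_alg_rel_mult free_alg_rel_gen)
  then show ?thesis using lpa_relators.E1_range[OF E1_range(2)] by (rule bexI)
next
  case (E2_range e)
  have "free_alg_rel G p (gen (Vertex (head E e)) * gen (Ghost e) - gen (Ghost e))"
    unfolding E2_range(1) by (intro free_alg_rel_diff free_alg_rel_mult free_alg_rel_gen)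
  then show ?thesis using lpa_relators.E2_range[OF E2_range(2)] by (rule bexI)
next
  case (E2_source e)
  have "free_alg_rel G p (gen (Ghost e) * gen (Vertex (tail E e)) - gen (Ghost e))"
    unfolding E2_source(1) by (intro free_alg_rel_diff free_alg_rel_mult free_alg_rel_gen)
  then show ?thesis using lpa_relators.E2_source[OF E2_source(2)] by (rule bexI)
next
  case (CK1 e f)
  have "free_alg_rel G p
      (gen (Ghost e) * gen (Edge f) - (if e = f then gen (Vertex (head E e)) else 0))"
    unfolding CK1(1)
    by (auto intro: free_alg_rel_diff free_alg_rel_mult free_alg_rel_gen free_alg_rel_0)
  then show ?thesis using lpa_relators.CK1[OF CK1(2,3)] by (rule bexI)
next
  case (CK2 v)
  have "free_alg_rel G p (gen (Vertex v) - (\<Sum>e \<in> out_arcs E v. gen (Edge e) * gen (Ghost e)))"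
    unfolding CK2(1)
    by (intro free_alg_rel_diff free_alg_rel_sum free_alg_rel_mult free_alg_rel_gen)
  then show ?thesis using lpa_relators.CK2[OF CK2(2)] by (rule bexI)
qed

lemma lpa_relators_rel_set:
  assumes "partial_embedding G"
  shows "rel_set (free_alg_rel G) (lpa_relators E) (lpa_relators E)"
  using partial_embedding.lpa_relators_rel[OF assms]
    partial_embedding.lpa_relators_rel[OF partial_embedding.converse[OF assms]]
  unfolding rel_set_def free_alg_rel_converse by blast

lemma countable_lpa_gens:
  "countable (verts E) \<Longrightarrow> countable (arcs E) \<Longrightarrow> countable (lpa_gens E)"
  by (simp add: lpa_gens_def)

lemma countable_lpa_relators:
  assumes "countable (verts E)" and "countable (arcs E)"
  shows "countable (lpa_relators E :: (('v, 'e) lpa_gen, 'r::comm_ring_1) free_alg set)"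
proof (rule countable_subset)
  let ?g = "gen :: ('v, 'e) lpa_gen \<Rightarrow> (('v, 'e) lpa_gen, 'r) free_alg"
  let ?V = "(\<lambda>(v, w). ?g (Vertex v) * ?g (Vertex w) - (if v = w then ?g (Vertex v) else 0))
      ` (verts E \<times> verts E)"
    and ?E1s = "(\<lambda>e. ?g (Vertex (tail E e)) * ?g (Edge e) - ?g (Edge e)) ` arcs E"
    and ?E1r = "(\<lambda>e. ?g (Edge e) * ?g (Vertex (head E e)) - ?g (Edge e)) ` arcs E"
    and ?E2r = "(\<lambda>e. ?g (Vertex (head E e)) * ?g (Ghost e) - ?g (Ghost e)) ` arcs E"
    and ?E2s = "(\<lambda>e. ?g (Ghost e) * ?g (Vertex (tail E e)) - ?g (Ghost e)) ` arcs E"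
    and ?CK1 = "(\<lambda>(e, f). ?g (Ghost e) * ?g (Edge f) -
      (if e = f then ?g (Vertex (head E e)) else 0)) ` (arcs E \<times> arcs E)"
    and ?CK2 = "(\<lambda>v. ?g (Vertex v) - (\<Sum>e \<in> out_arcs E v. ?g (Edge e) * ?g (Ghost e)))
      ` verts E"
  show "lpa_relators E \<subseteq> ?V \<union> ?E1s \<union> ?E1r \<union> ?E2r \<union> ?E2s \<union> ?CK1 \<union> ?CK2"
  proof
    fix p :: "(('v, 'e) lpa_gen, 'r) free_alg"
    assume "p \<in> lpa_relators E"
    then show "p \<in> ?V \<union> ?E1s \<union> ?E1r \<union> ?E2r \<union> ?E2s \<union> ?CK1 \<union> ?CK2"
    proof cases
      case (V v w)
      then have "p \<in> ?V" by (intro image_eqI[of _ _ "(v, w)"]) auto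
      then show ?thesis by blast
    next
      case (CK1 e f)
      then have "p \<in> ?CK1" by (intro image_eqI[of _ _ "(e, f)"]) auto
      then show ?thesis by blast
    next
      case (CK2 v)
      then have "v \<in> verts E" by (simp add: regular_vertices_def)
      with CK2 show ?thesis by blast
    qed blast+
  qed
  show "countable (?V \<union> ?E1s \<union> ?E1r \<union> ?E2r \<union> ?E2s \<union> ?CK1 \<union> ?CK2)"
    using assms by (intro countable_Un countable_image countable_SIGMA)
qed

lemma leavitt_path_algebra_isomorphic_transfer:
  fixes E1 :: "('v1, 'e1) pre_digraph" and E2 :: "('v2, 'e2) pre_digraph"
    and \<iota>1 :: "'k::alg_closed_field \<Rightarrow> 'f1::field" and \<iota>2 :: "'k \<Rightarrow> 'f2::field"
  assumes E1: "wf_digraph E1" "countable (verts E1)" "countable (arcs E1)"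
    and E2: "wf_digraph E2" "countable (verts E2)" "countable (arcs E2)"
    and k: "uncountable (UNIV :: 'k set)" "field_extension \<iota>1" "field_extension \<iota>2"
    and iso: "algebra_isomorphic
      (leavitt_path_algebra TYPE('f1) E1) (leavitt_path_algebra TYPE('f1) E2)"
  shows "algebra_isomorphic
    (leavitt_path_algebra TYPE('f2) E1) (leavitt_path_algebra TYPE('f2) E2)"
proof -
  let ?S = "lpa_relators E1 :: (('v1, 'e1) lpa_gen, 'f1) free_alg set"
    and ?T = "lpa_relators E2 :: (('v2, 'e2) lpa_gen, 'f1) free_alg set"
    and ?S' = "lpa_relators E1 :: (('v1, 'e1) lpa_gen, 'f2) free_alg set"
    and ?T' = "lpa_relators E2 :: (('v2, 'e2) lpa_gen, 'f2) free_alg set"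
  have S: "?S \<subseteq> free_algebra (lpa_gens E1)" and T: "?T \<subseteq> free_algebra (lpa_gens E2)"
    and S': "?S' \<subseteq> free_algebra (lpa_gens E1)" and T': "?T' \<subseteq> free_algebra (lpa_gens E2)"
    using E1(1) E2(1) by (auto dest: lpa_relators_subset)
  obtain f g where "inverse_substitutions (lpa_gens E1) ?S (lpa_gens E2) ?T f g"
    using inverse_substitutions_if_isomorphic[OF S T] iso
    unfolding leavitt_path_algebra_def by blast
  then obtain C where "countable C" and C: "\<And>G :: ('f1 \<times> 'f2) set. partial_embedding G \<Longrightarrow>
      C \<subseteq> Domain G \<Longrightarrow> rel_set (free_alg_rel G) ?S ?S' \<Longrightarrow> rel_set (free_alg_rel G) ?T ?T' \<Longrightarrow>
      \<exists>f g. inverse_substitutions (lpa_gens E1) ?S' (lpa_gens E2) ?T' f g"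
    using inverse_substitutions_transfer[OF countable_lpa_gens[OF E1(2,3)]
        countable_lpa_gens[OF E2(2,3)] countable_lpa_relators[OF E1(2,3)]
        countable_lpa_relators[OF E2(2,3)] S T, where S' = ?S' and T' = ?T']
    by blast
  obtain G :: "('f1 \<times> 'f2) set" where G: "partial_embedding G" "C \<subseteq> Domain G"
    using countable_partial_embedding_extension[OF \<open>countable C\<close> k] .
  obtain f g where "inverse_substitutions (lpa_gens E1) ?S' (lpa_gens E2) ?T' f g"
    using C[OF G lpa_relators_rel_set[OF G(1)] lpa_relators_rel_set[OF G(1)]] by blast
  then show ?thesis
    unfolding leavitt_path_algebra_def by (rule isomorphic_if_inverse_substitutions[OF S' T'])
qed

theorem corollary5p8:
  fixes E1 :: "('v1, 'e1) pre_digraph" and E2 :: "('v2, 'e2) pre_digraph"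
    and \<iota>1 :: "'k::alg_closed_field \<Rightarrow> 'f1::field" and \<iota>2 :: "'k \<Rightarrow> 'f2::field"
  assumes "wf_digraph E1" and "countable (verts E1)" and "countable (arcs E1)"
    and "wf_digraph E2" and "countable (verts E2)" and "countable (arcs E2)"
    and "uncountable (UNIV :: 'k set)"
    and "field_extension \<iota>1" and "field_extension \<iota>2"
  shows "algebra_isomorphic
           (leavitt_path_algebra TYPE('f1) E1) (leavitt_path_algebra TYPE('f1) E2)
     \<longleftrightarrow> algebra_isomorphic
           (leavitt_path_algebra TYPE('f2) E1) (leavitt_path_algebra TYPE('f2) E2)"
proof
  show "algebra_isomorphic
      (leavitt_path_algebra TYPE('f2) E1) (leavitt_path_algebra TYPE('f2) E2)"
    if "algebra_isomorphic
      (leavitt_path_algebra TYPE('f1) E1) (leavitt_path_algebra TYPE('f1) E2)"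
    by (rule leavitt_path_algebra_isomorphic_transfer[OF assms that])
  show "algebra_isomorphic
      (leavitt_path_algebra TYPE('f1) E1) (leavitt_path_algebra TYPE('f1) E2)"
    if "algebra_isomorphic
      (leavitt_path_algebra TYPE('f2) E1) (leavitt_path_algebra TYPE('f2) E2)"
    by (rule leavitt_path_algebra_isomorphic_transfer[OF assms(1-7,9,8) that])
qed

end
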